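(* Let $\mathcal A,\mathcal B$ be unital $C^*$-algebras with faithful traces $\tau,\omega$, respectively, let $\alpha>0$, $\alpha\neq1$, and let $\phi:\mathcal A_+^{-1}\to\mathcal B_+^{-1}$ be surjective. Then \[ \frac{\omega\text{-}Q^{mo}_\alpha(\phi(A)\|\phi(B))}{\omega(\phi(A))}=\frac{\tau\text{-}Q^{mo}_\alpha(A\|B)}{\tau(A)}\quad\text{for all }A,B\in\mathcal A_+^{-1} \] holds if and only if there are a central element $C\in\mathcal B_+^{-1}$ and a Jordan *-isomorphism $J:\mathcal A\to\mathcal B$ such that $\phi(A)=CJ(A)$ for all $A\in\mathcal A_+^{-1}$ and $\omega(CJ(X))=\frac{\omega(C)}{\tau(I)}\tau(X)$ for all $X\in\mathcal A$. In particular, any such surjective $\phi$ is a constant multiple of a map of the standard form.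
   Context: All $C^*$-algebras are unital with unit $I$; $\mathcal A_+^{-1}$ is the set of positive invertible elements. A trace $\tau$ is a positive linear functional with $\tau(AB)=\tau(BA)$; faithful means $\tau(A)=0$, $A\ge0$ implies $A=0$. $\tau\text{-}Q^{mo}_\alpha(A\|B)=\tau\big(\exp(\alpha\log A+(1-\alpha)\log B)\big)$. A Jordan *-isomorphism $J:\mathcal A\to\mathcal B$ is a linear bijection with $J(XY+YX)=J(X)J(Y)+J(Y)J(X)$ and $J(X^* )=J(X)^*$. A map $\psi:\mathcal A_+^{-1}\to\mathcal B_+^{-1}$ is of the standard form if $\psi(A)=DK(A)$ with a central $D\in\mathcal B_+^{-1}$ and a Jordan *-isomorphism $K$ such that $\omega(DK(X))=\tau(X)$ for all $X\in\mathcal A$. *)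

theory Defs
  imports "HOL-Analysis.Analysis"
begin

definition unital_cstar_algebra ::
  "(complex \<Rightarrow> 'a::{real_normed_algebra_1,banach} \<Rightarrow> 'a) \<Rightarrow> ('a \<Rightarrow> 'a) \<Rightarrow> bool" where
  "unital_cstar_algebra sc st \<longleftrightarrow>
     (\<forall>r x. sc (complex_of_real r) x = r *\<^sub>R x) \<and>
     (\<forall>a b x. sc (a + b) x = sc a x + sc b x) \<and>
     (\<forall>a x y. sc a (x + y) = sc a x + sc a y) \<and>
     (\<forall>a b x. sc (a * b) x = sc a (sc b x)) \<and>
     (\<forall>a x y. sc a (x * y) = sc a x * y \<and> sc a (x * y) = x * sc a y) \<and>
     (\<forall>a x. norm (sc a x) = cmod a * norm x) \<and>
     (\<forall>x y. st (x + y) = st x + st y) \<and>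
     (\<forall>a x. st (sc a x) = sc (cnj a) (st x)) \<and>
     (\<forall>x y. st (x * y) = st y * st x) \<and>
     (\<forall>x. st (st x) = x) \<and>
     (\<forall>x. norm (st x * x) = (norm x)\<^sup>2)"

definition cpositive :: "('a::{real_normed_algebra_1,banach} \<Rightarrow> 'a) \<Rightarrow> 'a \<Rightarrow> bool" where
  "cpositive st x \<longleftrightarrow> (\<exists>y. x = st y * y)"

definition cinvertible :: "'a::{real_normed_algebra_1,banach} \<Rightarrow> bool" where
  "cinvertible x \<longleftrightarrow> (\<exists>y. x * y = 1 \<and> y * x = 1)"

definition pos_inv :: "('a::{real_normed_algebra_1,banach} \<Rightarrow> 'a) \<Rightarrow> 'a set" where
  "pos_inv st = {x. cpositive st x \<and> cinvertible x}"

definition central :: "'a::{real_normed_algebra_1,banach} \<Rightarrow> bool" where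
  "central c \<longleftrightarrow> (\<forall>x. c * x = x * c)"

definition faithful_trace ::
  "(complex \<Rightarrow> 'a::{real_normed_algebra_1,banach} \<Rightarrow> 'a) \<Rightarrow> ('a \<Rightarrow> 'a) \<Rightarrow> ('a \<Rightarrow> complex) \<Rightarrow> bool" where
  "faithful_trace sc st \<tau> \<longleftrightarrow>
     (\<forall>x y. \<tau> (x + y) = \<tau> x + \<tau> y) \<and>
     (\<forall>a x. \<tau> (sc a x) = a * \<tau> x) \<and>
     (\<forall>x. cpositive st x \<longrightarrow> Im (\<tau> x) = 0 \<and> Re (\<tau> x) \<ge> 0) \<and>
     (\<forall>x y. \<tau> (x * y) = \<tau> (y * x)) \<and>
     (\<forall>x. cpositive st x \<and> \<tau> x = 0 \<longrightarrow> x = 0)"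

definition clog :: "('a::{real_normed_algebra_1,banach} \<Rightarrow> 'a) \<Rightarrow> 'a \<Rightarrow> 'a" where
  "clog st A = (THE L. st L = L \<and> exp L = A)"

definition Qmo ::
  "('a::{real_normed_algebra_1,banach} \<Rightarrow> complex) \<Rightarrow> ('a \<Rightarrow> 'a) \<Rightarrow> real \<Rightarrow> 'a \<Rightarrow> 'a \<Rightarrow> complex" where
  "Qmo \<tau> st \<alpha> A B = \<tau> (exp (\<alpha> *\<^sub>R clog st A + (1 - \<alpha>) *\<^sub>R clog st B))"

definition jordan_star_iso ::
  "(complex \<Rightarrow> 'a::{real_normed_algebra_1,banach} \<Rightarrow> 'a) \<Rightarrow> ('a \<Rightarrow> 'a) \<Rightarrow>
   (complex \<Rightarrow> 'b::{real_normed_algebra_1,banach} \<Rightarrow> 'b) \<Rightarrow> ('b \<Rightarrow> 'b) \<Rightarrow> ('a \<Rightarrow> 'b) \<Rightarrow> bool" where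
  "jordan_star_iso scA stA scB stB J \<longleftrightarrow>
     (\<forall>x y. J (x + y) = J x + J y) \<and>
     (\<forall>a x. J (scA a x) = scB a (J x)) \<and>
     bij J \<and>
     (\<forall>x y. J (x * y + y * x) = J x * J y + J y * J x) \<and>
     (\<forall>x. J (stA x) = stB (J x))"

definition standard_form ::
  "(complex \<Rightarrow> 'a::{real_normed_algebra_1,banach} \<Rightarrow> 'a) \<Rightarrow> ('a \<Rightarrow> 'a) \<Rightarrow> ('a \<Rightarrow> complex) \<Rightarrow>
   (complex \<Rightarrow> 'b::{real_normed_algebra_1,banach} \<Rightarrow> 'b) \<Rightarrow> ('b \<Rightarrow> 'b) \<Rightarrow> ('b \<Rightarrow> complex) \<Rightarrow>
   ('a \<Rightarrow> 'b) \<Rightarrow> bool" where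
  "standard_form scA stA \<tau> scB stB \<omega> \<psi> \<longleftrightarrow>
     \<psi> ` pos_inv stA \<subseteq> pos_inv stB \<and>
     (\<exists>D K. D \<in> pos_inv stB \<and> central D \<and> jordan_star_iso scA stA scB stB K \<and>
        (\<forall>A \<in> pos_inv stA. \<psi> A = D * K A) \<and>
        (\<forall>X. \<omega> (D * K X) = \<tau> X))"

end

theory Submission
  imports Defs
begin

text \<open>
  Put \<open>t = Re \<tau>\<close> (on either side). The trace yields \<open>\<A>\<^sub>+\<^sup>-\<^sup>1 = exp \<A>\<^sub>s\<^sub>a\<close> with unique logarithms, so \<open>\<phi>\<close> becomes a
  surjection \<open>f\<close> of the self-adjoint parts with \<open>\<phi> (exp a) = exp (f a)\<close>. Dividing the hypothesis for
  \<open>(a, b)\<close> by the one for \<open>(a, b')\<close> shows that \<open>f\<close> preserves the ratios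
  \<open>t (exp (\<alpha> a + (1 - \<alpha>) b)) / t (exp (\<alpha> a + (1 - \<alpha>) b'))\<close>; by Klein's inequality their suprema over
  \<open>a\<close> determine the norm \<open>N h = sup\<^sub>u \<bar>t (exp u h)\<bar> / t (exp u)\<close> of \<open>b - b'\<close>. Hence \<open>f\<close> is an \<open>N\<close>-isometry,
  and by Mazur--Ulam \<open>f = c + L\<close> with \<open>L\<close> linear. The hypothesis now reads
  \<open>t (exp (c + L x)) = k t (exp x)\<close>.

  Let \<open>d = L\<^sup>-\<^sup>1 c\<close>. First and second derivatives of this identity show that \<open>L\<close> is an order isomorphism,
  that \<open>L (exp (s d)) = exp (s c)\<close>, and that both \<open>P\<^sub>s x = exp (s d) x exp (s d)\<close> and
  \<open>Q\<^sub>s x = L\<^sup>-\<^sup>1 (exp (s c) (L x) exp (s c))\<close> are symmetric for the form \<open>t (x y)\<close>. So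
  \<open>W = Q\<^sub>-\<^sub>s\<^sub>/\<^sub>2 P\<^sub>s Q\<^sub>-\<^sub>s\<^sub>/\<^sub>2\<close> is positive for this form, and it is a unital order automorphism; its powers of both
  signs are bounded, which forces \<open>W = 1\<close>, i.e. \<open>P\<^sub>s = Q\<^sub>s\<close>. Comparing Hessians at \<open>-2d\<close> then gives
  \<open>t (g g) = \<integral>\<^sub>0\<^sup>1 t (exp (u d) g exp (- u d) g) dr\<close> with \<open>u = 2r - 1\<close>. The integrand is at least \<open>t (g g)\<close>, and
  equality means \<open>d g = g d\<close>. Exchanging the algebras, \<open>c\<close> is central, and the derivatives yield \<open>L (x\<^sup>2) = (L x)\<^sup>2\<close>.
\<close>

section \<open>The exponential in a Banach algebra\<close>

lemma continuous_on_exp_scaleR: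
  fixes a :: "'a::{real_normed_algebra_1,banach}"
  shows "continuous_on S (\<lambda>t. exp (t *\<^sub>R a))"
  by (rule continuous_on_vector_derivative) (rule exp_scaleR_has_vector_derivative_right)

lemma continuous_on_exp_compose_scaleR:
  fixes a :: "'a::{real_normed_algebra_1,banach}"
  assumes "continuous_on S f"
  shows "continuous_on S (\<lambda>t. exp (f t *\<^sub>R a))"
  using continuous_on_compose2[OF continuous_on_exp_scaleR[of UNIV a] assms] by simp

lemma exp_mult_exp_minus:
  fixes a :: "'a::{real_normed_algebra_1,banach}"
  shows "exp (- a) * exp a = 1" "exp a * exp (- a) = 1"
  using exp_minus_inverse[of "- a"] exp_minus_inverse[of a] by simp_all

lemma exp_scaleR_add:
  fixes a :: "'a::{real_normed_algebra_1,banach}"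
  shows "exp ((s + t) *\<^sub>R a) = exp (s *\<^sub>R a) * exp (t *\<^sub>R a)"
  by (simp add: scaleR_add_left exp_add_commuting)

lemma exp_scaleR_cancel:
  fixes a :: "'a::{real_normed_algebra_1,banach}"
  assumes "s + t = 0"
  shows "exp (s *\<^sub>R a) * exp (t *\<^sub>R a) = 1" "exp (s *\<^sub>R a) * (exp (t *\<^sub>R a) * x) = x"
proof -
  show 1: "exp (s *\<^sub>R a) * exp (t *\<^sub>R a) = 1"
    using exp_scaleR_add[of s t a] assms by simp
  show "exp (s *\<^sub>R a) * (exp (t *\<^sub>R a) * x) = x"
    by (simp add: 1 flip: mult.assoc)
qed

lemma exp_half:
  fixes a :: "'a::{real_normed_algebra_1,banach}"
  shows "exp ((1/2) *\<^sub>R a) * exp ((1/2) *\<^sub>R a) = exp a"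
  using exp_scaleR_add[of "1/2" "1/2" a] by simp

lemma exp_add_scaleR_one:
  fixes a :: "'a::{real_normed_algebra_1,banach}"
  shows "exp (a + r *\<^sub>R 1) = exp r *\<^sub>R exp a"
proof -
  have "exp (r *\<^sub>R (1::'a)) = exp r *\<^sub>R 1"
    using exp_of_real[of r, where 'a='a] by (simp add: of_real_def)
  then show ?thesis by (simp add: exp_add_commuting)
qed

lemma exp_commute:
  fixes a y :: "'a::{real_normed_algebra_1,banach}"
  assumes "a * y = y * a"
  shows "exp a * y = y * exp a"
proof -
  have p: "a ^ n * y = y * a ^ n" for n
    using assms by (rule power_commuting_commutes)
  have "exp a * y = (\<Sum>n. (a ^ n /\<^sub>R fact n) * y)"
    by (simp add: exp_def suminf_mult2 summable_exp_generic)
  also have "\<dots> = (\<Sum>n. y * (a ^ n /\<^sub>R fact n))"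
    by (simp add: p)
  also have "\<dots> = y * exp a"
    unfolding exp_def by (rule suminf_mult[OF summable_exp_generic])
  finally show ?thesis .
qed

text \<open>The integrand is the derivative of \<open>- exp ((1 - r) a) y exp (r b)\<close>. With
  \<open>y = 1\<close> the formula compares two exponentials; for general \<open>y\<close> it
  measures the failure of \<open>y\<close> to intertwine them.\<close>

lemma Duhamel_formula:
  fixes a b y :: "'a::{real_normed_algebra_1,banach}"
  shows "((\<lambda>r. exp ((1 - r) *\<^sub>R a) * (a * y - y * b) * exp (r *\<^sub>R b)) has_integral
           (exp a * y - y * exp b)) {0..1}"
proof -
  define F where "F r = - (exp ((1 - r) *\<^sub>R a) * y * exp (r *\<^sub>R b))" for r
  have *: "((\<lambda>r. exp ((1 - r) *\<^sub>R a)) has_vector_derivative (- 1) *\<^sub>R (exp ((1 - r) *\<^sub>R a) * a)) (at r within {0..1})" for r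
  proof -
    have "((\<lambda>r::real. 1 - r) has_vector_derivative - 1) (at r within {0..1})"
      unfolding has_real_derivative_iff_has_vector_derivative[symmetric]
      by (auto intro!: derivative_eq_intros)
    from vector_diff_chain_within[OF this exp_scaleR_has_vector_derivative_right]
    show ?thesis by (simp add: o_def)
  qed
  have "(F has_vector_derivative exp ((1 - r) *\<^sub>R a) * (a * y - y * b) * exp (r *\<^sub>R b)) (at r within {0..1})" for r
    unfolding F_def
    by (rule has_vector_derivative_eq_rhs,
        rule derivative_intros, rule has_vector_derivative_mult,
        rule has_vector_derivative_mult, rule *, rule derivative_intros,
        rule exp_scaleR_has_vector_derivative_left[THEN has_vector_derivative_at_within])
       (simp add: algebra_simps)
  then have "((\<lambda>r. exp ((1 - r) *\<^sub>R a) * (a * y - y * b) * exp (r *\<^sub>R b)) has_integral (F 1 - F 0)) {0..1}"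
    by (intro fundamental_theorem_of_calculus) auto
  then show ?thesis by (simp add: F_def)
qed

text \<open>This Duhamel integral will be the Frechet derivative of \<open>exp\<close> at
  \<open>a\<close> in the direction \<open>h\<close>.\<close>

definition dexp :: "'a::{real_normed_algebra_1,banach} \<Rightarrow> 'a \<Rightarrow> 'a" where
  "dexp a h = integral {0..1} (\<lambda>r. exp ((1 - r) *\<^sub>R a) * h * exp (r *\<^sub>R a))"

lemma dexp_has_integral:
  "((\<lambda>r. exp ((1 - r) *\<^sub>R a) * h * exp (r *\<^sub>R a)) has_integral dexp a h) {0..1}"
  unfolding dexp_def
  by (intro integrable_integral integrable_continuous_real continuous_intros continuous_on_exp_compose_scaleR)

text \<open>Bounded linear maps pass through the integral, so an intertwining relation has to be
  checked for each \<open>r\<close> only.\<close>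

lemma dexp_bounded_linear_commute:
  assumes "bounded_linear F" "\<And>r. exp ((1 - r) *\<^sub>R b) * h' * exp (r *\<^sub>R b) = F (exp ((1 - r) *\<^sub>R a) * h * exp (r *\<^sub>R a))"
  shows "dexp b h' = F (dexp a h)"
  using has_integral_linear[OF dexp_has_integral[of a h] assms(1)] dexp_has_integral[of b h']
  by (simp add: o_def assms(2)) (metis has_integral_unique)

lemma dexp_commuting:
  assumes "a * h = h * a"
  shows "dexp a h = exp a * h"
proof -
  have "exp ((1 - r) *\<^sub>R a) * h * exp (r *\<^sub>R a) = exp a * h" for r
  proof -
    have "exp ((1 - r) *\<^sub>R a) * h * exp (r *\<^sub>R a) = exp ((1 - r) *\<^sub>R a) * (exp (r *\<^sub>R a) * h)"
      using exp_commute[of "r *\<^sub>R a" h] assms by (simp add: mult.assoc)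
    also have "\<dots> = exp a * h"
      using exp_scaleR_add[of "1 - r" r a] by (simp flip: mult.assoc)
    finally show ?thesis .
  qed
  then show ?thesis by (simp add: dexp_def)
qed

section \<open>Norm estimates and differentiability of the exponential\<close>

lemma norm_has_integral_unit_le:
  fixes f :: "real \<Rightarrow> 'a::real_normed_vector"
  assumes "(f has_integral w) {0..1}" "\<And>r. r \<in> {0..1} \<Longrightarrow> norm (f r) \<le> B"
  shows "norm w \<le> B"
proof -
  have "norm (f 0) \<le> B" by (rule assms(2)) simp
  then have "0 \<le> B" by (rule order_trans[OF norm_ge_zero])
  then show ?thesis using has_integral_bound[of B f w 0 1] assms by simp
qed

lemma norm_exp_scaleR_le:
  fixes a :: "'a::{real_normed_algebra_1,banach}"
  assumes "\<bar>r\<bar> \<le> 1"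
  shows "norm (exp (r *\<^sub>R a)) \<le> exp (norm a)"
proof -
  have "norm (exp (r *\<^sub>R a)) \<le> exp (norm (r *\<^sub>R a))" by (rule norm_exp)
  also have "\<dots> \<le> exp (norm a)" using assms by (simp add: mult_left_le_one_le)
  finally show ?thesis .
qed

lemma norm_mult3_le:
  fixes x y z :: "'a::real_normed_algebra"
  assumes "norm x \<le> A" "norm y \<le> B" "norm z \<le> C"
  shows "norm (x * y * z) \<le> A * B * C"
proof -
  have "norm (x * y) \<le> A * B"
    by (rule order_trans[OF norm_mult_ineq]) (meson assms mult_mono norm_ge_zero order_trans)
  then show ?thesis
    by (intro order_trans[OF norm_mult_ineq]) (meson assms mult_mono norm_ge_zero order_trans)
qed

lemma norm_exp_diff_le:
  fixes a b :: "'a::{real_normed_algebra_1,banach}"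
  shows "norm (exp a - exp b) \<le> exp (norm a) * norm (a - b) * exp (norm b)"
proof (rule norm_has_integral_unit_le)
  show "((\<lambda>r. exp ((1 - r) *\<^sub>R a) * (a - b) * exp (r *\<^sub>R b)) has_integral exp a - exp b) {0..1}"
    using Duhamel_formula[of a 1 b] by simp
qed (auto intro!: norm_mult3_le norm_exp_scaleR_le)

lemma bounded_linear_dexp: "bounded_linear (dexp a)"
proof (rule bounded_linear_intro[of _ "exp (norm a) * exp (norm a)"])
  show "dexp a (x + y) = dexp a x + dexp a y" for x y
    by (rule has_integral_unique[OF dexp_has_integral])
       (use has_integral_add[OF dexp_has_integral[of a x] dexp_has_integral[of a y]] in \<open>simp add: algebra_simps\<close>)
  show "dexp a (r *\<^sub>R x) = r *\<^sub>R dexp a x" for r x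
    by (rule dexp_bounded_linear_commute) (auto intro: bounded_linear_intros)
  show "norm (dexp a x) \<le> norm x * (exp (norm a) * exp (norm a))" for x
  proof -
    have "norm (dexp a x) \<le> exp (norm a) * norm x * exp (norm a)"
      by (rule norm_has_integral_unit_le[OF dexp_has_integral])
         (auto intro!: norm_mult3_le norm_exp_scaleR_le)
    then show ?thesis by (simp add: mult_ac)
  qed
qed

text \<open>Subtracting \<open>dexp a h\<close> from Duhamel's formula for \<open>a + h\<close> and
  \<open>a\<close> leaves an integral whose first factor is a difference of exponentials. That
  factor is itself of order \<open>norm h\<close>, so the remainder is quadratic.\<close>

lemma norm_exp_remainder_le:
  fixes a h :: "'a::{real_normed_algebra_1,banach}"
  assumes "norm h \<le> 1"
  shows "norm (exp (a + h) - exp a - dexp a h) \<le> exp (norm a + 1) ^ 3 * norm h ^ 2"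
proof (rule norm_has_integral_unit_le)
  let ?K = "exp (norm a + 1)"
  show "((\<lambda>r. (exp ((1 - r) *\<^sub>R (a + h)) - exp ((1 - r) *\<^sub>R a)) * h * exp (r *\<^sub>R a)) has_integral
      (exp (a + h) - exp a - dexp a h)) {0..1}"
    using has_integral_diff[OF Duhamel_formula[of "a + h" 1 a] dexp_has_integral[of a h]]
    by (simp add: algebra_simps)
  fix r :: real assume r: "r \<in> {0..1}"
  have "norm (exp ((1 - r) *\<^sub>R (a + h)) - exp ((1 - r) *\<^sub>R a))
      \<le> exp (norm ((1 - r) *\<^sub>R (a + h))) * norm ((1 - r) *\<^sub>R (a + h) - (1 - r) *\<^sub>R a) * exp (norm ((1 - r) *\<^sub>R a))"
    by (rule norm_exp_diff_le)
  also have "\<dots> \<le> ?K * norm h * ?K"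
  proof (intro mult_mono)
    have "norm ((1 - r) *\<^sub>R (a + h)) \<le> norm (a + h)" using r by (simp add: mult_left_le_one_le)
    also have "\<dots> \<le> norm a + 1" using norm_triangle_ineq[of a h] assms by simp
    finally show "exp (norm ((1 - r) *\<^sub>R (a + h))) \<le> ?K" by simp
    have "norm ((1 - r) *\<^sub>R a) \<le> norm a" using r by (simp add: mult_left_le_one_le)
    then show "exp (norm ((1 - r) *\<^sub>R a)) \<le> ?K" by simp
    show "norm ((1 - r) *\<^sub>R (a + h) - (1 - r) *\<^sub>R a) \<le> norm h"
      using r by (simp add: mult_left_le_one_le flip: scaleR_diff_right)
  qed auto
  finally have 1: "norm (exp ((1 - r) *\<^sub>R (a + h)) - exp ((1 - r) *\<^sub>R a)) \<le> ?K * norm h * ?K" .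
  have 2: "norm (exp (r *\<^sub>R a)) \<le> ?K"
    using norm_exp_scaleR_le[of r a] r by (intro order_trans[OF norm_exp_scaleR_le]) auto
  show "norm ((exp ((1 - r) *\<^sub>R (a + h)) - exp ((1 - r) *\<^sub>R a)) * h * exp (r *\<^sub>R a)) \<le> ?K ^ 3 * norm h ^ 2"
    using norm_mult3_le[OF 1 order_refl[of "norm h"] 2] by (simp add: power2_eq_square power3_eq_cube mult_ac)
qed

lemma has_derivative_exp_dexp: "(exp has_derivative dexp a) (at a)"
  for a :: "'a::{real_normed_algebra_1,banach}"
  unfolding has_derivative_at
proof (intro conjI bounded_linear_dexp)
  let ?q = "\<lambda>h. norm (exp (a + h) - exp a - dexp a h) / norm h"
  show "?q \<midarrow>0\<rightarrow> 0"
  proof (rule Lim_null_comparison)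
    show "\<forall>\<^sub>F h in at 0. norm (?q h) \<le> exp (norm a + 1) ^ 3 * norm h"
      unfolding eventually_at
    proof (intro exI[of _ 1] conjI ballI impI)
      fix h :: 'a assume "h \<noteq> 0 \<and> dist h 0 < 1"
      then show "norm (?q h) \<le> exp (norm a + 1) ^ 3 * norm h"
        using norm_exp_remainder_le[of h a]
        by (simp add: divide_le_eq power2_eq_square mult.assoc)
    qed auto
    have "(\<lambda>h::'a. exp (norm a + 1) ^ 3 * norm h) \<midarrow>0\<rightarrow> exp (norm a + 1) ^ 3 * norm (0::'a)"
      by (intro tendsto_intros)
    then show "(\<lambda>h::'a. exp (norm a + 1) ^ 3 * norm h) \<midarrow>0\<rightarrow> 0" by simp
  qed
qed

lemma has_vector_derivative_exp:
  fixes f :: "real \<Rightarrow> 'a::{real_normed_algebra_1,banach}"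
  assumes "(f has_vector_derivative f') (at t within S)"
  shows "((\<lambda>t. exp (f t)) has_vector_derivative dexp (f t) f') (at t within S)"
  using vector_derivative_diff_chain_within[OF assms, of exp "dexp (f t)"]
    has_derivative_exp_dexp[of "f t"] has_derivative_at_withinI
  by (auto simp: o_def)

lemma has_vector_derivative_exp_line:
  fixes x h :: "'a::{real_normed_algebra_1,banach}"
  shows "((\<lambda>t. exp (x + t *\<^sub>R h)) has_vector_derivative dexp (x + t *\<^sub>R h) h) (at t)"
  by (rule has_vector_derivative_exp) (auto intro!: derivative_eq_intros)

section \<open>Logarithms near the unit\<close>

text \<open>The logarithm is the integral of \<open>- z R s\<close>, where \<open>R s\<close> is the
  inverse of \<open>1 - s z\<close> given by the geometric series. It inherits linear identities
  that hold on all powers of \<open>z\<close>; with \<open>F\<close> the involution, the last clause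
  will make it self-adjoint.\<close>

lemma log_one_minus_exists:
  fixes z :: "'a::{real_normed_algebra_1,banach}"
  assumes z: "norm z < 1"
  obtains l where "exp l = 1 - z" "\<And>y. y * z = z * y \<Longrightarrow> y * l = l * y"
    "\<And>F. bounded_linear F \<Longrightarrow> (\<And>n. F (z ^ n) = z ^ n) \<Longrightarrow> F l = l"
proof -
  define R where "R s = (\<Sum>n. (s *\<^sub>R z) ^ n)" for s :: real
  define l where "l t = integral {0..t} (\<lambda>s. - (z * R s))" for t
  have nz: "norm (s *\<^sub>R z) < 1" "norm (s *\<^sub>R z) \<le> norm z" if "s \<in> {0..1}" for s
    using that z mult_left_le_one_le[of "norm z" s] by (auto intro: le_less_trans)
  have smb: "summable (\<lambda>n. (s *\<^sub>R z) ^ n)" if "s \<in> {0..1}" for s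
    by (rule complete_algebra_summable_geometric[OF nz(1)[OF that]])
  have R1: "R s * (1 - s *\<^sub>R z) = 1" "(1 - s *\<^sub>R z) * R s = 1" if "s \<in> {0..1}" for s
  proof -
    have 1: "R s = 1 + (\<Sum>n. (s *\<^sub>R z) ^ Suc n)"
      unfolding R_def suminf_split_head[OF smb[OF that]] by simp
    have 2: "(\<Sum>n. (s *\<^sub>R z) ^ Suc n) = s *\<^sub>R z * R s"
      unfolding R_def power_Suc by (rule suminf_mult[OF smb[OF that]])
    have 3: "(\<Sum>n. (s *\<^sub>R z) ^ Suc n) = R s * (s *\<^sub>R z)"
      unfolding R_def power_Suc2 by (rule suminf_mult2[OF smb[OF that], symmetric])
    show "R s * (1 - s *\<^sub>R z) = 1" using 1 unfolding 3 right_diff_distrib by (metis add_diff_cancel_right' mult.right_neutral)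
    show "(1 - s *\<^sub>R z) * R s = 1" using 1 unfolding 2 left_diff_distrib by (metis add_diff_cancel_right' mult.left_neutral)
  qed
  have Rb: "norm (R s) \<le> 1 / (1 - norm z)" if "s \<in> {0..1}" for s
  proof -
    have "norm (R s) \<le> (\<Sum>n. norm z ^ n)"
      unfolding R_def
    proof (rule norm_suminf_le)
      show "norm ((s *\<^sub>R z) ^ n) \<le> norm z ^ n" for n
        by (rule order_trans[OF norm_power_ineq]) (intro power_mono nz(2)[OF that] norm_ge_zero)
    qed (use z in \<open>simp add: summable_geometric\<close>)
    then show ?thesis using z by (simp add: suminf_geometric)
  qed
  \<comment> \<open>The resolvent identity; with the uniform bound on \<open>R\<close> it gives
    Lipschitz continuity, hence integrability.\<close>
  have Rd: "R s - R t = (s - t) *\<^sub>R (R s * z * R t)" if "s \<in> {0..1}" "t \<in> {0..1}" for s t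
  proof -
    have "R s - R t = R s * ((1 - t *\<^sub>R z) * R t) - (R s * (1 - s *\<^sub>R z)) * R t"
      using R1[OF that(1)] R1[OF that(2)] by simp
    also have "\<dots> = (s - t) *\<^sub>R (R s * z * R t)" by (simp add: algebra_simps)
    finally show ?thesis .
  qed
  have "(1 / (1 - norm z) * norm z * (1 / (1 - norm z)))-lipschitz_on {0..1} R"
  proof (rule lipschitz_onI)
    fix s t :: real assume st: "s \<in> {0..1}" "t \<in> {0..1}"
    show "dist (R s) (R t) \<le> 1 / (1 - norm z) * norm z * (1 / (1 - norm z)) * dist s t"
      using mult_right_mono[OF norm_mult3_le[OF Rb[OF st(1)] order_refl[of "norm z"] Rb[OF st(2)]], of "\<bar>s - t\<bar>"]
      by (simp add: dist_norm Rd[OF st] mult.commute[of "\<bar>s - t\<bar>"])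
  qed (use z in simp)
  then have contR: "continuous_on {0..1} R" by (rule lipschitz_on_continuous_on)
  then have cont: "continuous_on {0..1} (\<lambda>s. - (z * R s))" by (intro continuous_intros)
  have hi: "((\<lambda>s. - (z * R s)) has_integral l 1) {0..1}"
    unfolding l_def by (intro integrable_integral integrable_continuous_real cont)
  have Rlin: "F (R s) = G (R s)" if "s \<in> {0..1}" "bounded_linear F" "bounded_linear G" "\<And>n. F (z ^ n) = G (z ^ n)" for F G :: "'a \<Rightarrow> 'a" and s
  proof -
    interpret F: bounded_linear F by fact
    interpret G: bounded_linear G by fact
    show ?thesis
      unfolding R_def F.suminf[OF smb[OF that(1)]] G.suminf[OF smb[OF that(1)]]
      by (simp add: F.scaleR G.scaleR that(4))
  qed
  have zR: "z * R s = R s * z" if "s \<in> {0..1}" for s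
    by (rule Rlin[OF that, of "(*) z" "\<lambda>x. x * z"]) (auto simp: power_commutes intro: bounded_linear_intros)
  \<comment> \<open>Left and right multiplication by \<open>y\<close> yield commutation; a map
    \<open>F\<close> paired with the identity yields invariance under \<open>F\<close>.\<close>
  have llin: "F (l t) = G (l t)" if "t \<in> {0..1}" "bounded_linear F" "bounded_linear G" "\<And>n. F (z ^ n) = G (z ^ n)" for F G :: "'a \<Rightarrow> 'a" and t
  proof -
    interpret F: bounded_linear F by fact
    interpret G: bounded_linear G by fact
    have c: "continuous_on {0..t} (\<lambda>s. - (z * R s))" using that(1) by (intro continuous_on_subset[OF cont]) auto
    have "F (l t) = integral {0..t} (\<lambda>s. F (- (z * R s)))"
      unfolding l_def using integral_linear[OF integrable_continuous_real[OF c] that(2)] by (simp add: o_def)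
    also have "\<dots> = integral {0..t} (\<lambda>s. G (- (z * R s)))"
    proof (rule integral_cong)
      fix s assume "s \<in> {0..t}"
      then have s: "s \<in> {0..1}" using that(1) by auto
      have "F (z * R s) = G (z * R s)"
      proof (rule Rlin[OF s, of "\<lambda>x. F (z * x)" "\<lambda>x. G (z * x)"])
        show "F (z * z ^ n) = G (z * z ^ n)" for n using that(4)[of "Suc n"] by simp
      qed (use that bounded_linear_compose[OF _ bounded_linear_mult_right[of z]] in auto)
      then show "F (- (z * R s)) = G (- (z * R s))" by (simp add: F.neg G.neg)
    qed
    also have "\<dots> = G (l t)"
      unfolding l_def using integral_linear[OF integrable_continuous_real[OF c] that(3)] by (simp add: o_def)
    finally show ?thesis .
  qed
  have lcomm: "y * l t = l t * y" if "t \<in> {0..1}" "y * z = z * y" for y t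
  proof (rule llin[OF that(1), of "(*) y" "\<lambda>x. x * y"])
    show "y * z ^ n = z ^ n * y" for n using power_commuting_commutes[of z y n] that(2) by simp
  qed (auto intro: bounded_linear_intros)
  have lR: "l t * R s = R s * l t" if "t \<in> {0..1}" "s \<in> {0..1}" for t s
    using lcomm[OF that(1), of "R s"] zR[OF that(2)] by simp
  \<comment> \<open>\<open>G\<close> has derivative zero and starts at \<open>1\<close>; its value
    at \<open>1\<close> then says that \<open>exp (- l 1)\<close> is inverse to
    \<open>1 - z\<close>.\<close>
  define G where "G t = exp (- l t) * (1 - t *\<^sub>R z)" for t
  have dG: "(G has_vector_derivative 0) (at t within {0..1})" if t: "t \<in> {0..1}" for t
  proof -
    have dl: "((\<lambda>t. - l t) has_vector_derivative z * R t) (at t within {0..1})"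
      using has_vector_derivative_minus[OF integral_has_vector_derivative[OF cont t]] by (simp add: l_def)
    have "((\<lambda>t. exp (- l t)) has_vector_derivative exp (- l t) * (z * R t)) (at t within {0..1})"
    proof (rule has_vector_derivative_eq_rhs[OF has_vector_derivative_exp[OF dl]])
      have "l t * (z * R t) = (z * R t) * l t"
        using lR[OF t t] lcomm[OF t, of z] by (metis mult.assoc)
      then show "dexp (- l t) (z * R t) = exp (- l t) * (z * R t)"
        by (intro dexp_commuting) simp
    qed
    then show ?thesis unfolding G_def
      by (rule has_vector_derivative_eq_rhs[OF has_vector_derivative_mult])
         (use R1[OF t] in \<open>auto intro!: derivative_eq_intros simp: mult.assoc\<close>)
  qed
  have "G 1 = G 0"
  proof -
    have "(G has_derivative (\<lambda>h. 0)) (at t within {0..1})" if "t \<in> {0..1}" for t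
      using dG[OF that] by (simp add: has_vector_derivative_def)
    then show ?thesis using has_derivative_zero_constant[of "{0..1}" G] by force
  qed
  then have "exp (- l 1) * (1 - z) = 1" by (simp add: G_def l_def)
  then have "exp (l 1) = exp (l 1) * exp (- l 1) * (1 - z)" by (simp add: mult.assoc)
  then have "exp (l 1) = 1 - z" by (simp add: exp_minus_inverse)
  then show thesis
    by (rule that) (auto intro: lcomm llin[of 1 _ "\<lambda>x. x"] bounded_linear_intros)
qed

section \<open>Self-adjoint elements and logarithms\<close>

locale cstar =
  fixes sc :: "complex \<Rightarrow> 'a::{real_normed_algebra_1,banach} \<Rightarrow> 'a" and st :: "'a \<Rightarrow> 'a"
  assumes cstar: "unital_cstar_algebra sc st"
begin

abbreviation sa :: "'a \<Rightarrow> bool" where "sa x \<equiv> st x = x"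

lemma sc_of_real: "sc (complex_of_real r) x = r *\<^sub>R x"
  and sc_add_left: "sc (a + b) x = sc a x + sc b x"
  and sc_add: "sc a (x + y) = sc a x + sc a y"
  and sc_mult: "sc (a * b) x = sc a (sc b x)"
  and sc_times: "sc b (x * y) = sc b x * y \<and> sc b (x * y) = x * sc b y"
  and st_add: "st (x + y) = st x + st y"
  and st_sc: "st (sc a x) = sc (cnj a) (st x)"
  and st_mult: "st (x * y) = st y * st x"
  and st_st: "st (st x) = x"
  and norm_st_mult: "norm (st x * x) = (norm x)\<^sup>2"
  using cstar unfolding unital_cstar_algebra_def
  by - (elim conjE, (erule allE)+, assumption)+

lemma sc_sc: "sc a (sc b x) = sc (a * b) x"
  and sc_mult_left: "sc a x * y = sc a (x * y)"
  and sc_mult_right: "x * sc a y = sc a (x * y)"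
  using sc_mult[of a b x] sc_times[of a x y] by metis+

lemma st_scaleR: "st (r *\<^sub>R x) = r *\<^sub>R st x"
  using st_sc[of "complex_of_real r" x] by (simp add: sc_of_real)

lemma sc_scaleR: "sc a (r *\<^sub>R x) = r *\<^sub>R sc a x"
  by (simp add: sc_sc mult.commute flip: sc_of_real)

lemma sc_i_i: "sc \<i> (sc \<i> x) = - x"
  using sc_of_real[of "-1" x] by (simp add: sc_sc)

lemma sc_uminus: "sc (- a) x = - sc a x"
  using sc_sc[of "-1" a x] sc_of_real[of "-1" "sc a x"] by simp

lemma sc_diff: "sc a (x - y) = sc a x - sc a y"
  using sc_add[of a x "- y"] sc_scaleR[of a "-1" y] by simp

lemma sc_complex: "sc a x = Re a *\<^sub>R x + Im a *\<^sub>R sc \<i> x"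
proof -
  have "sc a x = sc (complex_of_real (Re a)) x + sc (complex_of_real (Im a) * \<i>) x"
    using complex_eq[of a] by (metis sc_add_left mult.commute)
  then show ?thesis by (simp only: sc_of_real flip: sc_sc)
qed

lemma st_zero [simp]: "st 0 = 0"
  using st_scaleR[of 0 0] by simp

lemma st_minus: "st (- x) = - st x"
  using st_scaleR[of "-1" x] by simp

lemma st_diff: "st (x - y) = st x - st y"
  using st_add[of x "- y"] by (simp add: st_minus)

lemma st_one [simp]: "st 1 = 1"
  using st_mult[of "st 1" 1] by (simp add: st_st)

lemma norm_st [simp]: "norm (st x) = norm x"
proof -
  have le: "norm x \<le> norm (st x)" for x
  proof (cases "x = 0")
    case False
    have "norm x * norm x \<le> norm (st x) * norm x"
      using norm_mult_ineq[of "st x" x] by (simp add: norm_st_mult power2_eq_square)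
    then show ?thesis using False by simp
  qed simp
  show ?thesis using le[of x] le[of "st x"] by (simp add: st_st)
qed

lemma bounded_linear_st: "bounded_linear st"
  by (rule bounded_linear_intro[of _ 1]) (auto simp: st_add st_scaleR)

lemma st_power: "st (x ^ n) = st x ^ n"
  by (induction n) (auto simp: st_mult power_commutes)

lemma st_exp: "st (exp x) = exp (st x)"
proof -
  interpret st: bounded_linear st by (rule bounded_linear_st)
  show ?thesis
    unfolding exp_def st.suminf[OF summable_exp_generic] by (simp add: st_scaleR st_power)
qed

lemma sa_intros:
  "sa 0" "sa 1" "sa x \<Longrightarrow> sa y \<Longrightarrow> sa (x + y)" "sa x \<Longrightarrow> sa y \<Longrightarrow> sa (x - y)"
  "sa x \<Longrightarrow> sa (- x)" "sa x \<Longrightarrow> sa (r *\<^sub>R x)" "sa x \<Longrightarrow> sa (exp x)" "sa x \<Longrightarrow> sa (x * x)"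
  "sa x \<Longrightarrow> sa y \<Longrightarrow> sa (x * y * x)"
  by (auto simp: st_add st_diff st_minus st_scaleR st_exp st_mult mult.assoc)

lemma sa_decomp:
  obtains h k where "sa h" "sa k" "x = h + sc \<i> k"
proof
  let ?h = "(1/2) *\<^sub>R (x + st x)" and ?k = "(1/2) *\<^sub>R sc \<i> (st x - x)"
  show "sa ?h" by (simp add: st_scaleR st_add st_st add.commute)
  show "sa ?k" by (simp add: st_scaleR st_sc st_diff st_st sc_uminus sc_diff)
  show "x = ?h + sc \<i> ?k"
    by (simp add: sc_scaleR sc_i_i) (simp add: algebra_simps flip: scaleR_add_left)
qed

lemma exp_sa_is_square: "sa a \<Longrightarrow> exp a = st (exp ((1/2) *\<^sub>R a)) * exp ((1/2) *\<^sub>R a)"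
  by (simp add: st_exp st_scaleR exp_half)

lemma log_one_minus_sa:
  assumes "norm z < 1" "sa z"
  obtains l where "sa l" "exp l = 1 - z" "\<And>y. y * z = z * y \<Longrightarrow> y * l = l * y"
proof -
  from log_one_minus_exists[OF assms(1)] obtain l where
    l: "exp l = 1 - z" "\<And>y. y * z = z * y \<Longrightarrow> y * l = l * y"
    "\<And>F. bounded_linear F \<Longrightarrow> (\<And>n. F (z ^ n) = z ^ n) \<Longrightarrow> F l = l" by metis
  have "sa l" by (rule l(3)[OF bounded_linear_st]) (simp add: st_power assms)
  with l show thesis using that by blast
qed

lemma sqrt_one_minus_sa:
  assumes "norm z < 1" "sa z"
  obtains s where "sa s" "s * s = 1 - z" "\<And>y. y * z = z * y \<Longrightarrow> y * s = s * y"
proof -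
  obtain l where l: "sa l" "exp l = 1 - z" "\<And>y. y * z = z * y \<Longrightarrow> y * l = l * y"
    using log_one_minus_sa[OF assms] by metis
  show thesis
  proof (rule that[of "exp ((1/2) *\<^sub>R l)"])
    show "y * exp ((1/2) *\<^sub>R l) = exp ((1/2) *\<^sub>R l) * y" if "y * z = z * y" for y
      using exp_commute[of "(1/2) *\<^sub>R l" y] l(3)[OF that] by simp
  qed (use l in \<open>auto simp: exp_half sa_intros\<close>)
qed

text \<open>For commuting self-adjoint \<open>s\<close>, \<open>w\<close> the element \<open>u = s + i w\<close> satisfies
  \<open>u\<^sup>* u = s\<^sup>2 + w\<^sup>2\<close>, and \<open>s\<close> is its real part.\<close>

lemma norm_square_le_of_sum_squares:
  assumes "sa s" "sa w" "s * w = w * s" "s * s + w * w = r *\<^sub>R 1" "0 \<le> r"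
  shows "norm (s * s) \<le> r"
proof -
  define u where "u = s + sc \<i> w"
  have stu: "st u = s - sc \<i> w" by (simp add: u_def st_add st_sc sc_uminus assms)
  have "st u * u = s * s + w * w"
    unfolding stu unfolding u_def
    by (simp add: algebra_simps sc_mult_left sc_mult_right sc_i_i sc_diff assms(3))
  then have u2: "(norm u)\<^sup>2 = r" using norm_st_mult[of u] assms by simp
  have "s = (1/2) *\<^sub>R (u + st u)" by (simp add: stu) (simp add: u_def flip: scaleR_add_left)
  then have "norm s = (1/2) * norm (u + st u)" by (metis norm_scaleR real_norm_def abs_of_nonneg zero_le_divide_1_iff zero_le_numeral)
  then have "norm s \<le> norm u" using norm_triangle_ineq[of u "st u"] by simp
  then have "norm s * norm s \<le> r" unfolding u2[symmetric] power2_eq_square by (intro mult_mono) auto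
  then show ?thesis using norm_mult_ineq[of s s] by simp
qed

section \<open>Logarithms of squares of invertible self-adjoint elements\<close>

lemma sa_inverse:
  assumes "sa a" "a * b = 1" "b * a = 1"
  shows "sa b" "y * a = a * y \<Longrightarrow> y * b = b * y"
proof -
  have "st b = st b * (a * b)" by (simp add: assms)
  also have "\<dots> = st (a * b) * b" unfolding st_mult by (simp add: assms(1) mult.assoc)
  finally show "sa b" by (simp add: assms)
  assume "y * a = a * y"
  then have "b * (y * a) * b = b * (a * y) * b" by simp
  then show "y * b = b * y" using assms by (simp add: mult.assoc) (simp add: assms flip: mult.assoc)
qed

text \<open>Invertibility keeps \<open>a * a\<close> above some \<delta> > 0. As \<delta> is small
  against \<open>b * b\<close>, the element \<open>1 - \<delta> b b\<close> has a square root
  \<open>v\<close>, and \<open>(a v) (a v) = a a - \<delta>\<close>. With \<open>s\<close> a root of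
  \<open>1 - a a\<close>, the squares of \<open>s\<close> and \<open>a v\<close> sum to
  \<open>1 - \<delta>\<close>, which bounds \<open>norm (s * s)\<close>.\<close>

lemma norm_one_minus_square_less:
  assumes a: "sa a" and inv: "a * b = 1" "b * a = 1" and "norm a < 1"
  shows "norm (1 - a * a) < 1"
proof -
  note b = sa_inverse[OF a inv]
  define \<delta> where "\<delta> = 1 / (2 * (1 + norm (b * b)))"
  have \<delta>: "0 < \<delta>" "\<delta> < 1" "norm (\<delta> *\<^sub>R (b * b)) < 1"
  proof -
    define n where "n = norm (b * b)"
    have "0 \<le> n" by (simp add: n_def)
    then show "0 < \<delta>" "\<delta> < 1" "norm (\<delta> *\<^sub>R (b * b)) < 1"
      unfolding \<delta>_def norm_scaleR n_def[symmetric] by (auto simp: divide_less_eq)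
  qed
  have sb: "sa (\<delta> *\<^sub>R (b * b))" using b(1) by (simp add: sa_intros)
  obtain v where v: "sa v" "v * v = 1 - \<delta> *\<^sub>R (b * b)" "\<And>y. y * (\<delta> *\<^sub>R (b * b)) = \<delta> *\<^sub>R (b * b) * y \<Longrightarrow> y * v = v * y"
    using sqrt_one_minus_sa[OF \<delta>(3) sb] by metis
  have "norm (a * a) \<le> norm a * norm a" by (rule norm_mult_ineq)
  also have "\<dots> < 1" using mult_strict_mono'[of "norm a" 1 "norm a" 1] assms(4) by simp
  finally have na: "norm (a * a) < 1" .
  obtain s where s: "sa s" "s * s = 1 - a * a" "\<And>y. y * (a * a) = a * a * y \<Longrightarrow> y * s = s * y"
    using sqrt_one_minus_sa[OF na] a by (metis sa_intros(8))
  have av: "a * v = v * a" by (rule v(3)) (simp add: mult.assoc, metis inv mult.assoc mult_1_left mult_1_right)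
  have avs: "s * (a * v) = (a * v) * s"
    by (rule s(3)[symmetric]) (metis av mult.assoc)
  have "a * v * (a * v) = a * a * (v * v)" by (metis av mult.assoc)
  also have "\<dots> = a * a - \<delta> *\<^sub>R (a * (a * b) * b)" by (simp add: v(2) algebra_simps)
  also have "\<dots> = a * a - \<delta> *\<^sub>R 1" by (simp add: inv)
  finally have sum: "s * s + (a * v) * (a * v) = (1 - \<delta>) *\<^sub>R 1"
    by (simp add: s(2) algebra_simps)
  have "sa (a * v)" by (simp add: st_mult a v(1) av)
  from norm_square_le_of_sum_squares[OF s(1) this avs sum] \<delta>
  show ?thesis by (simp add: s(2))
qed

text \<open>Division by \<rho> > \<open>norm a\<close> brings the square within distance less than
  \<open>1\<close> of the unit, where logarithms exist; adding \<open>ln (\<rho> * \<rho>)\<close>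
  restores the scale.\<close>

lemma square_has_log:
  assumes "sa a" "a * b = 1" "b * a = 1"
  obtains m where "sa m" "exp m = a * a" "\<And>y. y * a = a * y \<Longrightarrow> y * m = m * y"
proof -
  define \<rho> where "\<rho> = norm a + 1"
  have \<rho>: "0 < \<rho>" "norm a < \<rho>" by (auto simp: \<rho>_def add_nonneg_pos)
  define a' where "a' = (1 / \<rho>) *\<^sub>R a"
  have a': "sa a'" "a' * (\<rho> *\<^sub>R b) = 1" "(\<rho> *\<^sub>R b) * a' = 1" "norm a' < 1"
    using assms \<rho> by (auto simp: a'_def sa_intros)
  define z where "z = 1 - a' * a'"
  have z: "norm z < 1" "sa z"
    unfolding z_def using norm_one_minus_square_less[OF a'] a'(1) by (auto simp: sa_intros)
  obtain l where l: "sa l" "exp l = 1 - z" "\<And>y. y * z = z * y \<Longrightarrow> y * l = l * y"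
    using log_one_minus_sa[OF z] by metis
  show thesis
  proof (rule that[of "l + ln (\<rho> * \<rho>) *\<^sub>R 1"])
    show "exp (l + ln (\<rho> * \<rho>) *\<^sub>R 1) = a * a"
      using \<rho> by (simp add: exp_add_scaleR_one l(2) z_def a'_def)
    show "y * (l + ln (\<rho> * \<rho>) *\<^sub>R 1) = (l + ln (\<rho> * \<rho>) *\<^sub>R 1) * y" if "y * a = a * y" for y
    proof -
      have "y * (a * a) = a * a * y" using that by (metis mult.assoc)
      then have "y * z = z * y" by (simp add: z_def a'_def algebra_simps)
      then show ?thesis using l(3) by (simp add: algebra_simps)
    qed
  qed (simp add: l sa_intros)
qed

lemma sc_zero [simp]: "sc a 0 = 0"
  using sc_scaleR[of a 0 0] by simp

lemma sc_minus: "sc a (- x) = - sc a x"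
  using sc_scaleR[of a "-1" x] by simp

lemma commute_of_sa:
  assumes "\<And>g. sa g \<Longrightarrow> x * g = g * x"
  shows "x * y = y * x"
proof -
  obtain h k where "sa h" "sa k" "y = h + sc \<i> k" by (rule sa_decomp)
  then show ?thesis using assms[of h] assms[of k]
    by (simp add: distrib_left distrib_right sc_mult_left sc_mult_right)
qed

lemma sa_decomp_unique:
  assumes "sa h" "sa k" "sa h'" "sa k'" "h + sc \<i> k = h' + sc \<i> k'"
  shows "h = h' \<and> k = k'"
proof -
  have "st (h + sc \<i> k) = st (h' + sc \<i> k')" using assms(5) by simp
  then have m: "h - sc \<i> k = h' - sc \<i> k'" using assms(1-4) by (simp add: st_add st_sc sc_uminus)
  have "2 *\<^sub>R h = (h + sc \<i> k) + (h - sc \<i> k)" by (simp add: scaleR_2)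
  also have "\<dots> = 2 *\<^sub>R h'" unfolding m assms(5) by (simp add: scaleR_2)
  finally have h: "h = h'" by simp
  then have "sc \<i> (sc \<i> k) = sc \<i> (sc \<i> k')" using assms(5) by simp
  then show ?thesis using h by (simp add: sc_i_i)
qed

end

section \<open>Traces\<close>

locale tracial = cstar sc st
  for sc :: "complex \<Rightarrow> 'a::{real_normed_algebra_1,banach} \<Rightarrow> 'a" and st :: "'a \<Rightarrow> 'a" +
  fixes \<tau> :: "'a \<Rightarrow> complex"
  assumes trace: "faithful_trace sc st \<tau>"
begin

definition t :: "'a \<Rightarrow> real" where "t x = Re (\<tau> x)"

lemma tau_add: "\<tau> (x + y) = \<tau> x + \<tau> y"
  and tau_sc: "\<tau> (sc a x) = a * \<tau> x"
  and tau_commute: "\<tau> (x * y) = \<tau> (y * x)"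
  using trace unfolding faithful_trace_def
  by - (elim conjE, (erule allE)+, assumption)+

lemma tau_pos: "cpositive st x \<Longrightarrow> Im (\<tau> x) = 0 \<and> Re (\<tau> x) \<ge> 0"
  using trace unfolding faithful_trace_def by meson

lemma tau_faithful: "cpositive st x \<Longrightarrow> \<tau> x = 0 \<Longrightarrow> x = 0"
  using trace unfolding faithful_trace_def by meson

lemma tau_scaleR: "\<tau> (r *\<^sub>R x) = r * \<tau> x"
  using tau_sc[of "complex_of_real r" x] by (simp add: sc_of_real)

lemma tau_diff: "\<tau> (x - y) = \<tau> x - \<tau> y"
  using tau_add[of x "- y"] tau_scaleR[of "-1" y] by simp

lemma t_add: "t (x + y) = t x + t y" and t_scaleR: "t (r *\<^sub>R x) = r * t x"
  and t_diff: "t (x - y) = t x - t y" and t_commute: "t (x * y) = t (y * x)"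
  by (simp_all add: t_def tau_add tau_scaleR tau_diff tau_commute[of x y])

lemma t_zero [simp]: "t 0 = 0"
  using t_scaleR[of 0 0] by simp

lemma t_square_nonneg: "0 \<le> t (st y * y)"
  using tau_pos[of "st y * y"] by (auto simp: t_def cpositive_def)

lemma t_square_eq_0: "t (st y * y) = 0 \<Longrightarrow> y = 0"
proof -
  assume "t (st y * y) = 0"
  then have "\<tau> (st y * y) = 0"
    using tau_pos[of "st y * y"] by (auto simp: t_def cpositive_def complex_eq_iff)
  then have "st y * y = 0" by (intro tau_faithful) (auto simp: cpositive_def)
  then have "(norm y)\<^sup>2 = 0" using norm_st_mult[of y] by simp
  then show "y = 0" by simp
qed

text \<open>This stands in for the order: a bound on \<open>norm h\<close> exhibits
  \<open>r - h\<close> as an exponential, on which the trace is known to be positive.\<close>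

lemma log_shift:
  assumes "sa h" "norm h < r"
  obtains v where "sa v" "exp v = r *\<^sub>R 1 - h"
proof -
  have r: "0 < r" using assms norm_ge_zero[of h] by linarith
  have "norm ((1/r) *\<^sub>R h) < 1" "sa ((1/r) *\<^sub>R h)" using assms r by (auto simp: sa_intros)
  then obtain l where l: "sa l" "exp l = 1 - (1/r) *\<^sub>R h"
    using log_one_minus_sa by metis
  show thesis
  proof (rule that)
    show "exp (l + ln r *\<^sub>R 1) = r *\<^sub>R 1 - h"
      using r by (simp add: exp_add_scaleR_one l(2) scaleR_diff_right)
  qed (simp add: l sa_intros)
qed

lemma Im_tau_sa:
  assumes "sa h"
  shows "Im (\<tau> h) = 0"
proof -
  obtain v where v: "sa v" "exp v = (norm h + 1) *\<^sub>R 1 - h"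
    using log_shift[OF assms, of "norm h + 1"] by auto
  have "Im (\<tau> (exp v)) = 0" "Im (\<tau> 1) = 0"
    using tau_pos[of "exp v"] tau_pos[of "st 1 * 1"] exp_sa_is_square[OF v(1)]
    unfolding cpositive_def by (blast, metis st_one mult_1_right)
  then show ?thesis by (simp add: v(2) tau_diff tau_scaleR)
qed

lemma tau_sa: "sa h \<Longrightarrow> \<tau> h = complex_of_real (t h)"
  by (simp add: t_def complex_eq_iff Im_tau_sa)

lemma t_st: "t (st x) = t x"
proof -
  obtain h k where x: "sa h" "sa k" "x = h + sc \<i> k" by (rule sa_decomp)
  then show ?thesis
    by (simp add: st_add st_sc t_add) (simp add: t_def tau_sc Im_tau_sa)
qed

lemma t_one_pos: "0 < t 1"
  using t_square_nonneg[of 1] t_square_eq_0[of 1] by (simp add: less_le) (metis zero_neq_one)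

text \<open>Splitting both exponentials into halves \<open>P\<close>, \<open>Q\<close> and using
  cyclicity turns the expression into the trace of \<open>w\<close> times its adjoint, with
  \<open>w = P v Q\<close>. Faithfulness gives \<open>w = 0\<close>, and \<open>P\<close>,
  \<open>Q\<close> are invertible.\<close>

lemma t_exp_conj_nonneg:
  assumes "sa a" "sa b"
  shows "0 \<le> t (exp a * v * exp b * st v)" "t (exp a * v * exp b * st v) = 0 \<Longrightarrow> v = 0"
proof -
  define P where "P = exp ((1/2) *\<^sub>R a)"
  define Q where "Q = exp ((1/2) *\<^sub>R b)"
  have PQ: "exp a = P * P" "exp b = Q * Q" "sa P" "sa Q"
    using assms by (auto simp: P_def Q_def exp_half sa_intros)
  have "t (exp a * v * exp b * st v) = t (P * v * Q * Q * st v * P)"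
    using t_commute[of P "P * v * Q * Q * st v"] by (simp add: PQ(1,2) mult.assoc)
  also have "\<dots> = t (st (st (P * v * Q)) * st (P * v * Q))"
    by (simp add: st_st) (simp add: st_mult PQ mult.assoc)
  finally have *: "t (exp a * v * exp b * st v) = t (st (st (P * v * Q)) * st (P * v * Q))" .
  then show "0 \<le> t (exp a * v * exp b * st v)" by (simp only: t_square_nonneg)
  assume "t (exp a * v * exp b * st v) = 0"
  then have "st (P * v * Q) = 0" unfolding * by (rule t_square_eq_0)
  then have "P * v * Q = 0" by (metis st_st st_zero)
  then have "exp (- ((1/2) *\<^sub>R a)) * P * v * (Q * exp (- ((1/2) *\<^sub>R b))) = 0"
    by (simp add: mult.assoc) (simp flip: mult.assoc)
  then show "v = 0" by (simp add: P_def Q_def exp_mult_exp_minus)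
qed

lemma t_exp_pos: "sa a \<Longrightarrow> 0 < t (exp a)"
  using t_exp_conj_nonneg(1)[of a 0 1] t_exp_conj_nonneg(2)[of a 0 1]
  by (simp add: less_le) (metis zero_neq_one)

lemma t_exp_exp_nonneg: "sa a \<Longrightarrow> sa b \<Longrightarrow> 0 \<le> t (exp a * exp b)"
  using t_exp_conj_nonneg[of a b 1] by simp

text \<open>Boundedness of the trace comes from positivity: for self-adjoint \<open>h\<close> both
  \<open>r - h\<close> and \<open>r + h\<close> have positive trace whenever
  \<open>r > norm h\<close>. The general case follows because \<open>t\<close> sees only the
  self-adjoint part of \<open>x\<close>.\<close>

lemma t_abs_le: "\<bar>t x\<bar> \<le> norm x * t 1"
proof -
  have less: "\<bar>t h\<bar> \<le> r * t 1" if h: "sa h" "norm h < r" for h r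
  proof -
    obtain v where v: "sa v" "exp v = r *\<^sub>R 1 - h" using log_shift[OF h] by auto
    obtain w where w: "sa w" "exp w = r *\<^sub>R 1 - (- h)"
      using log_shift[of "- h" r] h by (auto simp: sa_intros)
    show ?thesis using t_exp_pos[OF v(1)] t_exp_pos[OF w(1)]
      by (simp add: v w t_diff t_add t_scaleR)
  qed
  have sa: "\<bar>t h\<bar> \<le> norm h * t 1" if "sa h" for h
  proof (rule field_le_epsilon)
    fix e :: real assume "0 < e"
    then show "\<bar>t h\<bar> \<le> norm h * t 1 + e"
      using less[OF that, of "norm h + e / t 1"] t_one_pos by (simp add: algebra_simps)
  qed
  let ?h = "(1/2) *\<^sub>R (x + st x)"
  have "t x = t ?h" by (simp add: t_scaleR t_add t_st)
  moreover have "\<bar>t ?h\<bar> \<le> norm ?h * t 1" by (rule sa) (simp add: st_scaleR st_add st_st add.commute)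
  moreover have "norm ?h \<le> norm x" using norm_triangle_ineq[of x "st x"] by simp
  then have "norm ?h * t 1 \<le> norm x * t 1" using t_one_pos by (intro mult_right_mono) auto
  ultimately show ?thesis by linarith
qed

lemma bounded_linear_t: "bounded_linear t"
  by (rule bounded_linear_intro[of _ "t 1"]) (auto simp: t_add t_scaleR t_abs_le)

lemma continuous_on_t [continuous_intros]: "continuous_on S f \<Longrightarrow> continuous_on S (\<lambda>x. t (f x))"
  by (rule bounded_linear.continuous_on[OF bounded_linear_t])

text \<open>Pairing Duhamel's formula with \<open>st v\<close>, where \<open>v = a y - y b\<close>,
  gives a continuous nonnegative function with integral zero; its value at \<open>r = 0\<close>
  forces \<open>v = 0\<close>. The case \<open>y = 1\<close> is uniqueness of logarithms, and
  \<open>a = b\<close> passes commutation from an exponential to its exponent.\<close>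

lemma exp_intertwine:
  assumes "sa a" "sa b" "exp a * y = y * exp b"
  shows "a * y = y * b"
proof -
  define v where "v = a * y - y * b"
  let ?F = "\<lambda>r. t (exp ((1 - r) *\<^sub>R a) * v * exp (r *\<^sub>R b) * st v)"
  have bl: "bounded_linear (\<lambda>x. t (x * st v))"
    by (rule bounded_linear_compose[OF bounded_linear_t bounded_linear_mult_left])
  have "(?F has_integral 0) {0..1}"
    using has_integral_linear[OF Duhamel_formula[of a y b] bl] assms(3)
    by (simp add: o_def v_def)
  moreover have "continuous_on {0..1} ?F"
    by (intro continuous_intros continuous_on_exp_compose_scaleR)
  moreover have nn: "0 \<le> ?F r" for r
    using t_exp_conj_nonneg(1)[of "(1 - r) *\<^sub>R a" "r *\<^sub>R b" v] assms by (simp add: sa_intros)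
  ultimately have "\<forall>r\<in>{0..1}. ?F r = 0"
    using integral_eq_0_iff[of 0 1 ?F] integral_unique[of ?F 0 "{0..1}"] by simp
  then have "?F 0 = 0" by (rule bspec) simp
  then have "v = 0" using t_exp_conj_nonneg(2)[of a 0 v] assms by simp
  then show ?thesis by (simp add: v_def)
qed

lemma exp_inj_sa: "sa a \<Longrightarrow> sa b \<Longrightarrow> exp a = exp b \<Longrightarrow> a = b"
  using exp_intertwine[of a b 1] by simp

lemma clog_exp: "sa a \<Longrightarrow> clog st (exp a) = a"
  unfolding clog_def by (rule the_equality) (auto intro: exp_inj_sa)

text \<open>If \<open>A = y\<^sup>* y\<close> and \<open>P = exp (m/2)\<close> is the positive square root of \<open>A\<^sup>2\<close>, then
  \<open>p = P - A\<close> satisfies \<open>A p = - P p\<close>. So \<open>t (p A p)\<close> is both \<open>\<ge> 0\<close> and \<open>\<le> 0\<close>, and faithfulness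
  gives \<open>p = 0\<close>; the trace replaces the spectral argument here.\<close>

lemma pos_inv_eq: "pos_inv st = exp ` {a. sa a}"
proof (intro set_eqI iffI)
  fix A assume "A \<in> exp ` {a. sa a}"
  then obtain a where a: "sa a" "A = exp a" by auto
  then show "A \<in> pos_inv st"
    unfolding pos_inv_def cpositive_def cinvertible_def
    using exp_sa_is_square[OF a(1)] exp_mult_exp_minus[of a] by auto
next
  fix A assume "A \<in> pos_inv st"
  then obtain y b where y: "A = st y * y" and b: "A * b = 1" "b * A = 1"
    unfolding pos_inv_def cpositive_def cinvertible_def by auto
  have A: "sa A" by (simp add: y st_mult st_st)
  obtain m where m: "sa m" "exp m = A * A" "\<And>y. y * A = A * y \<Longrightarrow> y * m = m * y"
    using square_has_log[OF A b] by metis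
  define P where "P = exp ((1/2) *\<^sub>R m)"
  define p where "p = P - A"
  have P: "sa P" "P * P = A * A" by (simp_all add: P_def exp_half m sa_intros)
  have PA: "P * A = A * P"
    unfolding P_def by (rule exp_commute) (use m(3)[of A] in simp)
  have Ap: "A * p = - (P * p)" by (simp add: p_def algebra_simps P PA)
  have sp: "sa p" by (simp add: p_def P A sa_intros)
  have "t (st (y * p) * (y * p)) = t (p * (A * p))"
    by (simp add: st_mult sp y mult.assoc)
  also have "\<dots> = - t (p * P * p)" using t_scaleR[of "-1" "p * P * p"] by (simp add: Ap mult.assoc)
  also have "p * P * p = st (st p) * (P * st p)" by (simp add: st_st sp mult.assoc)
  also have "t \<dots> = t (exp ((1/2) *\<^sub>R m) * p * exp 0 * st p)"
    using t_commute[of p "P * p"] by (simp add: P_def sp st_st mult.assoc)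
  finally have "t (exp ((1/2) *\<^sub>R m) * p * exp 0 * st p) \<le> 0"
    using t_square_nonneg[of "y * p"] by linarith
  then have "p = 0"
    using t_exp_conj_nonneg(1)[of "(1/2) *\<^sub>R m" 0 p] t_exp_conj_nonneg(2)[of "(1/2) *\<^sub>R m" 0 p] sa_intros(1) sa_intros(6)[OF m(1)]
    by (metis order_antisym)
  then show "A \<in> exp ` {a. sa a}" using m(1) by (auto simp: p_def P_def sa_intros intro!: image_eqI[of _ _ "(1/2) *\<^sub>R m"])
qed

section \<open>Derivatives and convexity of the trace exponential\<close>

lemma t_dexp: "t (dexp a h) = t (exp a * h)"
proof -
  have "((\<lambda>r. t (exp ((1 - r) *\<^sub>R a) * h * exp (r *\<^sub>R a))) has_integral t (dexp a h)) {0..1}"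
    using has_integral_linear[OF dexp_has_integral bounded_linear_t] by (simp add: o_def)
  \<comment> \<open>By cyclicity the integrand is independent of \<open>r\<close>.\<close>
  moreover have "t (exp ((1 - r) *\<^sub>R a) * h * exp (r *\<^sub>R a)) = t (exp a * h)" for r
    using t_commute[of "exp ((1 - r) *\<^sub>R a) * h" "exp (r *\<^sub>R a)"] exp_scaleR_add[of r "1 - r" a]
    by (simp flip: mult.assoc)
  ultimately show ?thesis by (simp add: has_integral_iff)
qed

lemma t_exp_line_derivative:
  "((\<lambda>s. t (exp (x + s *\<^sub>R h) * k)) has_real_derivative t (dexp (x + s *\<^sub>R h) h * k)) (at s)"
proof -
  have bl: "bounded_linear (\<lambda>x. t (x * k))"
    by (rule bounded_linear_compose[OF bounded_linear_t bounded_linear_mult_left])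
  show ?thesis
    unfolding has_real_derivative_iff_has_vector_derivative
    by (rule bounded_linear.has_vector_derivative[OF bl has_vector_derivative_exp_line])
qed

lemma t_exp_line_derivative_one:
  "((\<lambda>s. t (exp (x + s *\<^sub>R h))) has_real_derivative t (exp (x + s *\<^sub>R h) * h)) (at s)"
  using t_exp_line_derivative[of x h 1 s] by (simp add: t_dexp)

lemma t_exp_diff_nonneg:
  assumes "sa x" "sa h"
  shows "0 \<le> t ((exp (x + h) - exp x) * h)"
proof -
  have bl: "bounded_linear (\<lambda>x. t (x * h))"
    by (rule bounded_linear_compose[OF bounded_linear_t bounded_linear_mult_left])
  have "((\<lambda>r. t (exp ((1 - r) *\<^sub>R (x + h)) * h * exp (r *\<^sub>R x) * h)) has_integral t ((exp (x + h) - exp x) * h)) {0..1}"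
    using has_integral_linear[OF Duhamel_formula[of "x + h" 1 x] bl] by (simp add: o_def)
  then show ?thesis
    by (rule has_integral_nonneg)
       (metis assms sa_intros(3,6) t_exp_conj_nonneg(1))
qed

text \<open>The mean value theorem equates the difference with the derivative at some
  \<open>x + z h\<close>, and the gradient is monotone. Monotonicity is applied to the increment
  \<open>z h\<close>, whence the factor \<open>z\<close> that is cancelled.\<close>

lemma Klein_inequality:
  assumes "sa x" "sa h"
  shows "t (exp x * h) \<le> t (exp (x + h)) - t (exp x)"
proof -
  obtain z where z: "0 < z" "z < 1" and eq: "t (exp (x + 1 *\<^sub>R h)) - t (exp (x + 0 *\<^sub>R h)) = (1 - 0) * t (exp (x + z *\<^sub>R h) * h)"
    using MVT2[of 0 1 "\<lambda>s. t (exp (x + s *\<^sub>R h))" "\<lambda>s. t (exp (x + s *\<^sub>R h) * h)"] t_exp_line_derivative_one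
    by auto
  have "0 \<le> z * t ((exp (x + z *\<^sub>R h) - exp x) * h)"
    using t_exp_diff_nonneg[of x "z *\<^sub>R h"] assms by (simp add: sa_intros t_scaleR)
  then have "0 \<le> t ((exp (x + z *\<^sub>R h) - exp x) * h)" using z by (simp add: zero_le_mult_iff)
  then show ?thesis using eq by (simp add: left_diff_distrib t_diff)
qed

end

section \<open>The Mazur--Ulam theorem for norms on real subspaces\<close>

text \<open>The norm is an explicit function on a set because it will be \<open>N\<close> on the
  self-adjoint elements, not the norm of the algebra.\<close>

locale normed_subspace =
  fixes S :: "'v::real_vector set" and N :: "'v \<Rightarrow> real"
  assumes subspace: "subspace S"
    and N_triangle: "x \<in> S \<Longrightarrow> y \<in> S \<Longrightarrow> N (x + y) \<le> N x + N y"
    and N_scaleR: "x \<in> S \<Longrightarrow> N (r *\<^sub>R x) = \<bar>r\<bar> * N x"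
    and N_eq_0: "x \<in> S \<Longrightarrow> N x = 0 \<Longrightarrow> x = 0"
begin

lemmas in_S = subspace_0[OF subspace] subspace_add[OF subspace] subspace_diff[OF subspace]
  subspace_scale[OF subspace]

lemma N_minus_commute: "x \<in> S \<Longrightarrow> y \<in> S \<Longrightarrow> N (x - y) = N (y - x)"
  using N_scaleR[of "x - y" "-1"] by (simp add: in_S)

lemma N_zero: "N 0 = 0"
  using N_scaleR[of 0 0] by (simp add: in_S)

lemma N_nonneg: "x \<in> S \<Longrightarrow> 0 \<le> N x"
  using N_triangle[of x "-1 *\<^sub>R x"] N_scaleR[of x "-1"] N_zero in_S(4)[of x "-1"] by simp

lemma N_diff_le: "x \<in> S \<Longrightarrow> y \<in> S \<Longrightarrow> N (x - y) \<le> N x + N y"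
  using N_triangle[of x "-1 *\<^sub>R y"] N_scaleR[of y "-1"] in_S(4)[of y "-1"] by simp

definition self_isometry :: "('v \<Rightarrow> 'v) \<Rightarrow> bool" where
  "self_isometry g \<longleftrightarrow> bij_betw g S S \<and> (\<forall>x\<in>S. \<forall>y\<in>S. N (g x - g y) = N (x - y))"

lemma self_isometry_comp:
  assumes "self_isometry g" "self_isometry h"
  shows "self_isometry (g \<circ> h)"
  using assms unfolding self_isometry_def by (auto intro: bij_betw_trans) (metis bij_betwE)

lemma self_isometry_inv:
  assumes "self_isometry g"
  shows "self_isometry (inv_into S g)"
proof -
  have g: "bij_betw g S S" "\<And>x y. x \<in> S \<Longrightarrow> y \<in> S \<Longrightarrow> N (g x - g y) = N (x - y)"
    using assms by (auto simp: self_isometry_def)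
  show ?thesis unfolding self_isometry_def
  proof (intro conjI ballI bij_betw_inv_into g(1))
    fix x y assume "x \<in> S" "y \<in> S"
    then show "N (inv_into S g x - inv_into S g y) = N (x - y)"
      using g(2)[of "inv_into S g x" "inv_into S g y"] bij_betw_inv_into[OF g(1)]
      by (simp add: bij_betw_inv_into_right[OF g(1)] bij_betwE)
  qed
qed

lemma self_isometry_reflection:
  assumes "c \<in> S"
  shows "self_isometry (\<lambda>x. c - x)"
  unfolding self_isometry_def
proof (intro conjI ballI)
  show "bij_betw (\<lambda>x. c - x) S S"
    by (rule bij_betwI[of _ _ _ "\<lambda>x. c - x"]) (use assms in \<open>auto simp: in_S\<close>)
  show "N (c - x - (c - y)) = N (x - y)" if "x \<in> S" "y \<in> S" for x y
    using N_minus_commute[OF that] by simp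
qed

text \<open>With the reflection \<open>\<psi> x = 2z - x\<close>, passing from \<open>g\<close> to \<open>\<psi> g\<^sup>-\<^sup>1 \<psi> g\<close> doubles the distance by which
  the midpoint \<open>z\<close> is moved, while this distance is at most \<open>2 N (z - a)\<close>.\<close>

lemma self_isometry_fixes_midpoint:
  assumes g: "self_isometry g" "g a = a" "g b = b" and ab: "a \<in> S" "b \<in> S"
  shows "g ((1/2) *\<^sub>R (a + b)) = (1/2) *\<^sub>R (a + b)"
proof -
  define z where "z = (1/2) *\<^sub>R (a + b)"
  define \<psi> where "\<psi> x = a + b - x" for x
  have zS: "z \<in> S" by (simp add: z_def in_S ab)
  have \<psi>: "self_isometry \<psi>" unfolding \<psi>_def[abs_def] by (rule self_isometry_reflection) (simp add: in_S ab)
  have zz: "a + b = z + z" by (simp add: z_def flip: scaleR_add_left)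
  have inS: "self_isometry h \<Longrightarrow> x \<in> S \<Longrightarrow> h x \<in> S" for h x
    by (auto simp: self_isometry_def bij_betwE)
  have iso: "self_isometry h \<Longrightarrow> x \<in> S \<Longrightarrow> y \<in> S \<Longrightarrow> N (h x - h y) = N (x - y)" for h x y
    by (auto simp: self_isometry_def)
  have "2 ^ n * N (h z - z) \<le> 2 * N (z - a)" if "self_isometry h" "h a = a" "h b = b" for n h
    using that
  proof (induction n arbitrary: h)
    case 0
    have "N (h z - z) \<le> N (h z - a) + N (a - z)"
      using N_triangle[of "h z - a" "a - z"] inS[OF 0(1) zS] ab zS by (simp add: in_S)
    also have "N (h z - a) = N (z - a)" using iso[OF 0(1) zS ab(1)] 0(2) by simp
    finally show ?case using N_minus_commute[OF ab(1) zS] by simp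
  next
    case (Suc n)
    define k where "k = \<psi> \<circ> inv_into S h \<circ> \<psi> \<circ> h"
    have inv: "self_isometry (inv_into S h)" by (rule self_isometry_inv) fact
    have inj: "inj_on h S" using Suc.prems(1) by (auto simp: self_isometry_def bij_betw_def)
    have hS: "h z \<in> S" "\<psi> (h z) \<in> S" using inS Suc.prems(1) \<psi> zS by auto
    have "self_isometry k" unfolding k_def by (intro self_isometry_comp \<psi> inv Suc.prems)
    moreover have "k a = a" "k b = b"
      using inv_into_f_f[OF inj ab(1)] inv_into_f_f[OF inj ab(2)] Suc.prems(2,3)
      by (simp_all add: k_def \<psi>_def)
    ultimately have "2 ^ n * N (k z - z) \<le> 2 * N (z - a)" by (rule Suc.IH)
    moreover have "N (k z - z) = 2 * N (h z - z)"
    proof -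
      have "N (k z - z) = N (\<psi> (inv_into S h (\<psi> (h z))) - \<psi> z)"
        by (simp add: k_def) (simp add: \<psi>_def zz)
      also have "\<dots> = N (inv_into S h (\<psi> (h z)) - inv_into S h (h z))"
        using iso[OF \<psi> inS[OF inv hS(2)] zS] inv_into_f_f[OF inj zS] by simp
      also have "\<dots> = N (\<psi> (h z) - h z)" by (rule iso[OF inv hS(2,1)])
      also have "\<psi> (h z) - h z = (-2) *\<^sub>R (h z - z)" by (simp add: \<psi>_def zz algebra_simps flip: scaleR_2)
      also have "N \<dots> = 2 * N (h z - z)" by (subst N_scaleR) (simp_all add: in_S hS zS)
      finally show ?thesis .
    qed
    ultimately show ?case by (simp add: mult_ac)
  qed
  from this[OF g] have le: "2 ^ n * N (g z - z) \<le> 2 * N (z - a)" for n .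
  have "N (g z - z) = 0"
  proof (rule ccontr)
    assume "N (g z - z) \<noteq> 0"
    then have pos: "0 < N (g z - z)" using N_nonneg[of "g z - z"] inS[OF g(1) zS] zS by (simp add: in_S less_le)
    obtain n where "2 * N (z - a) / N (g z - z) < 2 ^ n" using real_arch_pow[of 2] by auto
    then show False using le[of n] pos by (simp add: divide_less_eq)
  qed
  then show ?thesis using N_eq_0[of "g z - z"] inS[OF g(1) zS] zS by (simp add: in_S z_def)
qed

end

locale surjective_isometry = E: normed_subspace S N + F: normed_subspace T M
  for S :: "'v::real_vector set" and N and T :: "'w::real_vector set" and M +
  fixes f :: "'v \<Rightarrow> 'w"
  assumes surj: "f ` S = T" and isometry: "x \<in> S \<Longrightarrow> y \<in> S \<Longrightarrow> M (f x - f y) = N (x - y)"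
begin

lemma f_in [simp]: "x \<in> S \<Longrightarrow> f x \<in> T" using surj by auto

lemma bij: "bij_betw f S T"
  unfolding bij_betw_def
proof (intro conjI inj_onI surj)
  fix x y assume xy: "x \<in> S" "y \<in> S" "f x = f y"
  then have "N (x - y) = 0" using isometry[of x y] F.N_zero by simp
  then show "x = y" using E.N_eq_0[of "x - y"] xy by (simp add: E.in_S)
qed

text \<open>Reflecting in the target, pulling back along \<open>f\<close> and reflecting in the
  source gives a self-isometry \<open>g\<close> that fixes \<open>a\<close> and \<open>b\<close>,
  hence their midpoint \<open>z\<close>. Unwound, this says that \<open>f z\<close> is fixed by the
  reflection exchanging \<open>f a\<close> and \<open>f b\<close>.\<close>

lemma midpoint:
  assumes ab: "a \<in> S" "b \<in> S"
  shows "f ((1/2) *\<^sub>R (a + b)) = (1/2) *\<^sub>R (f a + f b)"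
proof -
  define z where "z = (1/2) *\<^sub>R (a + b)"
  have zS: "z \<in> S" by (simp add: z_def E.in_S ab)
  define r where "r y = f a + f b - y" for y
  define i where "i = inv_into S f"
  define g where "g = (\<lambda>x. a + b - x) \<circ> (i \<circ> r \<circ> f)"
  have i: "bij_betw i T S" "\<And>y. y \<in> T \<Longrightarrow> f (i y) = y" "\<And>x. x \<in> S \<Longrightarrow> i (f x) = x"
    using bij bij_betw_inv_into bij_betw_inv_into_right bij_betw_inv_into_left by (auto simp: i_def)
  have iS: "y \<in> T \<Longrightarrow> i y \<in> S" for y using i(1) by (auto simp: bij_betwE)
  have r: "F.self_isometry r" unfolding r_def[abs_def]
    by (rule F.self_isometry_reflection) (simp add: F.in_S ab)
  then have rT: "bij_betw r T T" "\<And>y. y \<in> T \<Longrightarrow> r y \<in> T" by (auto simp: F.self_isometry_def bij_betwE)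
  have "E.self_isometry (i \<circ> r \<circ> f)"
    unfolding E.self_isometry_def
  proof (intro conjI ballI)
    show "bij_betw (i \<circ> r \<circ> f) S S" by (intro bij_betw_trans[OF bij] bij_betw_trans[OF rT(1)] i(1))
    fix x y assume xy: "x \<in> S" "y \<in> S"
    have "N (i (r (f x)) - i (r (f y))) = M (r (f x) - r (f y))"
      using isometry[OF iS iS] xy rT i(2) by simp
    also have "\<dots> = N (x - y)"
      using r xy isometry by (simp add: F.self_isometry_def)
    finally show "N ((i \<circ> r \<circ> f) x - (i \<circ> r \<circ> f) y) = N (x - y)" by simp
  qed
  then have "E.self_isometry g" unfolding g_def
    by (intro E.self_isometry_comp E.self_isometry_reflection) (simp_all add: E.in_S ab)
  moreover have "g a = a" "g b = b" by (simp_all add: g_def r_def i(3) ab)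
  ultimately have "g z = z" using E.self_isometry_fixes_midpoint[of g a b] ab by (simp add: z_def)
  then have "i (r (f z)) = a + b - z" by (simp add: g_def algebra_simps)
  moreover have "a + b = z + z" by (simp add: z_def flip: scaleR_add_left)
  ultimately have "i (r (f z)) = z" by simp
  then have "r (f z) = f z" using i(2)[OF rT(2)] zS by (metis f_in)
  then have "f a + f b = f z + f z" by (simp add: r_def algebra_simps)
  then show ?thesis by (simp add: z_def flip: scaleR_add_left)
qed

definition L :: "'v \<Rightarrow> 'w" where "L x = f x - f 0"

lemma L_half: "x \<in> S \<Longrightarrow> L ((1/2) *\<^sub>R x) = (1/2) *\<^sub>R L x"
  using midpoint[of x 0] by (simp add: L_def E.in_S algebra_simps flip: scaleR_add_left)

lemma L_add:
  assumes "x \<in> S" "y \<in> S"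
  shows "L (x + y) = L x + L y"
proof -
  have "(1/2) *\<^sub>R L (x + y) = L ((1/2) *\<^sub>R (x + y))" by (rule L_half[symmetric]) (simp add: E.in_S assms)
  also have "\<dots> = (1/2) *\<^sub>R (L x + L y)"
    unfolding L_def midpoint[OF assms] by (simp add: algebra_simps flip: scaleR_add_left)
  finally show ?thesis by simp
qed

lemma L_in: "x \<in> S \<Longrightarrow> L x \<in> T"
  by (simp add: L_def F.in_S E.in_S)

lemma L_norm: "x \<in> S \<Longrightarrow> M (L x) = N x"
  unfolding L_def using isometry[of x 0] by (simp add: E.in_S)

text \<open>The defect \<open>g r = L (r x) - r L x\<close> is additive in \<open>r\<close> and has period \<open>1\<close>, so it is bounded and
  therefore zero.\<close>

lemma L_scaleR:
  assumes x: "x \<in> S"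
  shows "L (r *\<^sub>R x) = r *\<^sub>R L x"
proof -
  define g where "g r = L (r *\<^sub>R x) - r *\<^sub>R L x" for r
  have gT: "g r \<in> T" for r unfolding g_def by (intro F.in_S L_in E.in_S x)
  have add: "g (r + s) = g r + g s" for r s
    unfolding g_def using L_add[of "r *\<^sub>R x" "s *\<^sub>R x"] x by (simp add: algebra_simps E.in_S)
  have g0: "g 0 = 0" using add[of 0 0] by simp
  have gm: "g (- r) = - g r" for r using add[of r "- r"] g0 by (simp add: eq_neg_iff_add_eq_0 add.commute)
  have mult: "g (real n * r) = real n *\<^sub>R g r" for n r
    by (induction n) (simp_all add: g0 add algebra_simps)
  have g1: "g 1 = 0" by (simp add: g_def)
  have gnat: "g (real n) = 0" for n using mult[of n 1] g1 by simp
  have gint: "g (of_int k) = 0" for k :: int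
    using gnat[of "nat k"] gm[of "real (nat (- k))"] gnat[of "nat (- k)"]
    by (cases "0 \<le> k") simp_all
  have bnd: "M (g r) \<le> 2 * N x" for r
  proof -
    define s where "s = r - of_int \<lfloor>r\<rfloor>"
    have s: "0 \<le> s" "s \<le> 1" unfolding s_def by linarith+
    have "g r = g s" using add[of s "of_int \<lfloor>r\<rfloor>"] gint by (simp add: s_def)
    also have "M (g s) \<le> M (L (s *\<^sub>R x)) + M (s *\<^sub>R L x)"
      unfolding g_def by (rule F.N_diff_le) (auto intro!: F.in_S L_in E.in_S x)
    also have "\<dots> = 2 * (s * N x)"
      using s by (simp add: L_norm E.in_S x F.N_scaleR L_in E.N_scaleR)
    also have "\<dots> \<le> 2 * N x" using s E.N_nonneg[OF x] by (simp add: mult_left_le_one_le)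
    finally show ?thesis .
  qed
  have "M (g r) = 0"
  proof (rule ccontr)
    assume "M (g r) \<noteq> 0"
    then have pos: "0 < M (g r)" using F.N_nonneg[OF gT] by (simp add: less_le)
    obtain n where n: "2 * N x < real n * M (g r)" using reals_Archimedean3[OF pos] by blast
    show False using bnd[of "real n * r"] n by (simp add: mult F.N_scaleR gT)
  qed
  then have "g r = 0" by (rule F.N_eq_0[OF gT])
  then show ?thesis by (simp add: g_def)
qed

lemma L_bij: "bij_betw L S T"
proof -
  have "bij_betw (\<lambda>y. y - f 0) T T"
    by (rule bij_betwI[of _ _ _ "\<lambda>y. y + f 0"]) (auto simp: F.in_S E.in_S)
  from bij_betw_trans[OF bij this] show ?thesis by (simp add: o_def L_def[abs_def])
qed

end

section \<open>The order and the norm determined by a trace\<close>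

context tracial
begin

text \<open>The product is \<open>st y * y\<close> with \<open>y = exp (u/2) exp d\<close> and has
  an evident inverse, so it is positive and invertible.\<close>

lemma exp_conj_eq_exp:
  assumes "sa d" "sa u"
  obtains w where "sa w" "exp d * exp u * exp d = exp w"
proof -
  let ?y = "exp ((1/2) *\<^sub>R u) * exp d"
  let ?z = "exp (- d) * exp (- u) * exp (- d)"
  have 1: "exp d * exp u * exp d = st ?y * ?y"
    using assms by (simp add: st_mult st_exp st_scaleR mult.assoc flip: exp_half[of u])
  have "exp d * exp u * exp d * ?z = exp d * (exp u * (exp d * exp (- d)) * exp (- u)) * exp (- d)"
    "?z * (exp d * exp u * exp d) = exp (- d) * (exp (- u) * (exp (- d) * exp d) * exp u) * exp d"
    by (simp_all only: mult.assoc)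
  then have "exp d * exp u * exp d * ?z = 1" "?z * (exp d * exp u * exp d) = 1"
    by (simp_all add: exp_mult_exp_minus)
  then have "exp d * exp u * exp d \<in> pos_inv st"
    unfolding pos_inv_def cpositive_def cinvertible_def using 1 by blast
  then show thesis using that unfolding pos_inv_eq by auto
qed

text \<open>Positivity as the trace sees it, tested against positive invertible elements. In this
  form it can be transported by identities between first derivatives of trace exponentials.\<close>

definition tpos :: "'a \<Rightarrow> bool" where
  "tpos h \<longleftrightarrow> (\<forall>u. sa u \<longrightarrow> 0 \<le> t (exp u * h))"

lemma tpos_conj:
  assumes "tpos h" "sa d"
  shows "tpos (exp d * h * exp d)"
  unfolding tpos_def
proof (intro allI impI)
  fix u assume "sa u"
  obtain w where w: "sa w" "exp d * exp u * exp d = exp w"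
    using exp_conj_eq_exp[OF assms(2) \<open>sa u\<close>] by metis
  have "t (exp u * (exp d * h * exp d)) = t (exp d * exp u * exp d * h)"
    using t_commute[of "exp u * exp d * h" "exp d"] by (simp add: mult.assoc)
  then show "0 \<le> t (exp u * (exp d * h * exp d))" using assms(1) w by (simp add: tpos_def)
qed

text \<open>Absorbing \<open>r\<close> into \<open>h\<close> reduces to the case
  \<open>r = 0\<close>. Klein's inequality at \<open>u\<close> with increment \<open>g\<close> gives
  one direction, at \<open>x + g\<close> with increment \<open>- g\<close> the other.\<close>

lemma ratio_le_iff:
  assumes "sa h"
  shows "(\<forall>x. sa x \<longrightarrow> t (exp (x + h)) \<le> exp r * t (exp x)) \<longleftrightarrow>
         (\<forall>u. sa u \<longrightarrow> t (exp u * h) \<le> r * t (exp u))" (is "?L \<longleftrightarrow> ?R")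
proof -
  define g where "g = h - r *\<^sub>R 1"
  have g: "sa g" "h = g + r *\<^sub>R 1" by (simp_all add: g_def assms sa_intros)
  have L: "t (exp (x + h)) \<le> exp r * t (exp x) \<longleftrightarrow> t (exp (x + g)) \<le> t (exp x)" for x
    using exp_add_scaleR_one[of "x + g" r] by (simp add: g(2) add.assoc t_scaleR)
  have R: "t (exp u * h) \<le> r * t (exp u) \<longleftrightarrow> t (exp u * g) \<le> 0" for u
    by (simp add: g_def right_diff_distrib t_diff t_scaleR)
  show ?thesis unfolding L R
  proof (intro iffI allI impI)
    fix u assume *: "\<forall>x. sa x \<longrightarrow> t (exp (x + g)) \<le> t (exp x)" "sa u"
    then show "t (exp u * g) \<le> 0" using Klein_inequality[OF *(2) g(1)] by force
  next
    fix x assume *: "\<forall>u. sa u \<longrightarrow> t (exp u * g) \<le> 0" "sa x"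
    have "t (exp (x + g) * - g) \<le> t (exp (x + g + - g)) - t (exp (x + g))"
      by (rule Klein_inequality) (use *(2) g(1) in \<open>simp_all add: sa_intros\<close>)
    moreover have "t (exp (x + g) * g) \<le> 0" using *(1)[rule_format, of "x + g"] *(2) g(1) by (simp add: sa_intros)
    moreover have "t (exp (x + g) * - g) = - t (exp (x + g) * g)"
      using t_scaleR[of "-1" "exp (x + g) * g"] by simp
    ultimately show "t (exp (x + g)) \<le> t (exp x)" by simp
  qed
qed

text \<open>Defined through the trace alone, so that a map preserving ratios of trace exponentials
  preserves it.\<close>

definition N :: "'a \<Rightarrow> real" where
  "N h = (SUP u\<in>{u. sa u}. \<bar>t (exp u * h)\<bar> / t (exp u))"

lemma t_exp_mult_le:
  assumes "sa h" "norm h < r" "sa u"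
  shows "\<bar>t (exp u * h)\<bar> \<le> r * t (exp u)"
proof -
  obtain v where v: "sa v" "exp v = r *\<^sub>R 1 - h" using log_shift[OF assms(1,2)] by auto
  obtain w where w: "sa w" "exp w = r *\<^sub>R 1 - (- h)"
    using log_shift[of "- h" r] assms by (auto simp: sa_intros)
  show ?thesis using t_exp_exp_nonneg[OF assms(3) v(1)] t_exp_exp_nonneg[OF assms(3) w(1)]
    by (simp add: v w t_diff t_add t_scaleR algebra_simps)
qed

lemma N_le_iff:
  assumes "sa h"
  shows "N h \<le> r \<longleftrightarrow> (\<forall>u. sa u \<longrightarrow> \<bar>t (exp u * h)\<bar> \<le> r * t (exp u))"
proof -
  have "bdd_above ((\<lambda>u. \<bar>t (exp u * h)\<bar> / t (exp u)) ` {u. sa u})"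
    using t_exp_mult_le[OF assms, of "norm h + 1"] t_exp_pos
    by (intro bdd_aboveI[of _ "norm h + 1"]) (auto simp: divide_le_eq)
  moreover have "{u. sa u} \<noteq> {}" using sa_intros(1) by blast
  ultimately show ?thesis
    unfolding N_def using t_exp_pos by (simp add: cSUP_le_iff divide_le_eq)
qed

lemma N_bound: "sa h \<Longrightarrow> sa u \<Longrightarrow> \<bar>t (exp u * h)\<bar> \<le> N h * t (exp u)"
  using N_le_iff[of h "N h"] by simp

lemma N_le_iff_tpos:
  assumes "sa h"
  shows "N h \<le> r \<longleftrightarrow> tpos (r *\<^sub>R 1 - h) \<and> tpos (r *\<^sub>R 1 + h)"
  unfolding N_le_iff[OF assms] tpos_def
  by (auto simp: right_diff_distrib distrib_left t_diff t_add t_scaleR abs_le_iff)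

lemma normed_subspace_sa: "normed_subspace {h. sa h} N"
proof
  show "subspace {h. sa h}" by (auto simp: subspace_def sa_intros)
  show "N (x + y) \<le> N x + N y" if "x \<in> {h. sa h}" "y \<in> {h. sa h}" for x y
  proof -
    have "\<bar>t (exp u * (x + y))\<bar> \<le> (N x + N y) * t (exp u)" if u: "sa u" for u
      using N_bound[OF _ u, of x] N_bound[OF _ u, of y] \<open>x \<in> _\<close> \<open>y \<in> _\<close>
      by (simp add: distrib_left distrib_right t_add)
    then show ?thesis using N_le_iff[of "x + y"] that by (simp add: sa_intros)
  qed
  have le: "N (r *\<^sub>R x) \<le> \<bar>r\<bar> * N x" if "sa x" for r x
  proof -
    have "\<bar>t (exp u * (r *\<^sub>R x))\<bar> \<le> \<bar>r\<bar> * N x * t (exp u)" if u: "sa u" for u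
      using mult_left_mono[OF N_bound[OF \<open>sa x\<close> u], of "\<bar>r\<bar>"]
      by (simp add: t_scaleR abs_mult mult.assoc)
    then show ?thesis using N_le_iff[of "r *\<^sub>R x"] that by (simp add: sa_intros)
  qed
  show "N (r *\<^sub>R x) = \<bar>r\<bar> * N x" if "x \<in> {h. sa h}" for x r
  proof (cases "r = 0")
    case True
    have "N 0 \<le> 0" using N_le_iff[of 0 0] by simp
    moreover have "0 \<le> N 0" using N_bound[of 0 0] t_exp_pos[of 0] by (simp add: zero_le_mult_iff)
    ultimately show ?thesis using True by simp
  next
    case False
    have "\<bar>r\<bar> * N ((1/r) *\<^sub>R (r *\<^sub>R x)) \<le> \<bar>r\<bar> * (\<bar>1/r\<bar> * N (r *\<^sub>R x))"
      by (intro mult_left_mono le) (use that in \<open>simp_all add: sa_intros\<close>)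
    then have "\<bar>r\<bar> * N x \<le> N (r *\<^sub>R x)" using False by (simp add: abs_mult[symmetric] flip: mult.assoc)
    then show ?thesis using le[of x r] that by simp
  qed
  show "x = 0" if "x \<in> {h. sa h}" "N x = 0" for x
  proof -
    have x: "sa x" using that by simp
    \<comment> \<open>If \<open>N x = 0\<close>, this function of \<open>s\<close> vanishes
      identically; its derivative at \<open>0\<close> is \<open>t (x * x)\<close>, so faithfulness
      applies.\<close>
    have 0: "t (exp (0 + s *\<^sub>R x) * x) = 0" for s
      using N_bound[OF x, of "s *\<^sub>R x"] that(2) x by (simp add: sa_intros)
    have "((\<lambda>s::real. 0) has_real_derivative t (dexp (0 + 0 *\<^sub>R x) x * x)) (at 0)"
      using t_exp_line_derivative[of 0 x x 0] unfolding 0 .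
    then have "t (dexp 0 x * x) = 0" using DERIV_unique[OF _ DERIV_const] by fastforce
    then have "t (st x * x) = 0" by (simp add: dexp_commuting x)
    then show "x = 0" by (rule t_square_eq_0)
  qed
qed

end

section \<open>Power-bounded positive operators on the self-adjoint part\<close>

text \<open>By convexity a positive increment would persist, and the sequence would grow at least
  linearly.\<close>

lemma convex_bounded_seq_decreasing:
  fixes u :: "nat \<Rightarrow> real"
  assumes convex: "\<And>n. u (Suc n) - u n \<le> u (Suc (Suc n)) - u (Suc n)" and bound: "\<And>n. u n \<le> C"
  shows "u (Suc m) \<le> u m"
proof (rule ccontr)
  define \<delta> where "\<delta> = u (Suc m) - u m"
  assume "\<not> u (Suc m) \<le> u m"
  then have \<delta>: "0 < \<delta>" by (simp add: \<delta>_def)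
  have step: "\<delta> \<le> u (Suc (m + n)) - u (m + n)" for n
    by (induction n) (use convex in \<open>auto simp: \<delta>_def intro: order_trans\<close>)
  have "u m + real n * \<delta> \<le> u (m + n)" for n
  proof (induction n)
    case (Suc n)
    then show ?case using step[of n] by (simp add: algebra_simps)
  qed simp
  then have "u m + real n * \<delta> \<le> C" for n using bound order_trans by blast
  then have "real n * \<delta> \<le> C - u m" for n by (simp add: le_diff_eq add.commute)
  moreover obtain n where "C - u m < real n * \<delta>" using reals_Archimedean3[OF \<delta>] by blast
  ultimately show False by (simp add: not_less[symmetric])
qed

context tracial
begin

text \<open>Here \<open>x\<close> is a multiple of \<open>exp 0\<close> minus \<open>exp v\<close>,
  and \<open>N\<close> controls the pairing with each exponential.\<close>

lemma t_pairing_bound: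
  assumes "sa x"
  obtains C where "\<And>z. sa z \<Longrightarrow> t (z * x) \<le> N z * C"
proof -
  obtain v where v: "sa v" "exp v = (norm x + 1) *\<^sub>R 1 - x"
    using log_shift[OF assms, of "norm x + 1"] by auto
  show thesis
  proof (rule that[of "(norm x + 1) * t 1 + t (exp v)"])
    fix z assume z: "sa z"
    have "z * x = (norm x + 1) *\<^sub>R (exp 0 * z) - z * exp v" by (simp add: v(2) algebra_simps)
    then have "t (z * x) = (norm x + 1) * t (exp 0 * z) - t (exp v * z)"
      using t_commute[of z "exp v"] by (simp add: t_diff t_scaleR)
    also have "\<dots> \<le> (norm x + 1) * (N z * t (exp 0)) + N z * t (exp v)"
    proof -
      have "(norm x + 1) * t (exp 0 * z) \<le> (norm x + 1) * (N z * t (exp 0))"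
        by (rule mult_left_mono) (use N_bound[OF z sa_intros(1)] in auto)
      moreover have "- t (exp v * z) \<le> N z * t (exp v)" using N_bound[OF z v(1)] by simp
      ultimately show ?thesis by linarith
    qed
    finally show "t (z * x) \<le> N z * ((norm x + 1) * t 1 + t (exp v))" by (simp add: algebra_simps)
  qed
qed

lemma t_sa_square: "sa x \<Longrightarrow> 0 \<le> t (x * x)" "sa x \<Longrightarrow> t (x * x) = 0 \<Longrightarrow> x = 0"
  using t_square_nonneg[of x] t_square_eq_0[of x] by simp_all

text \<open>With \<open>v = W x - x\<close>, the second differences of \<open>t (W^n x * x)\<close>
  are \<open>t (W^n v * v)\<close>, so this sequence is convex. Contractivity in \<open>N\<close>
  bounds it above, hence it decreases.\<close>

lemma contractive_symmetric_le:
  assumes sa: "\<And>x. sa x \<Longrightarrow> sa (W x)"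
    and diff: "\<And>x y. sa x \<Longrightarrow> sa y \<Longrightarrow> W (x - y) = W x - W y"
    and sym: "\<And>x y. sa x \<Longrightarrow> sa y \<Longrightarrow> t (W x * y) = t (x * W y)"
    and pos: "\<And>x. sa x \<Longrightarrow> 0 \<le> t (W x * x)"
    and contr: "\<And>x. sa x \<Longrightarrow> N (W x) \<le> N x"
    and x: "sa x"
  shows "t (W x * W x) \<le> t (W x * x)"
proof -
  have sa_pow: "sa y \<Longrightarrow> sa ((W ^^ n) y)" for n y by (induction n) (auto simp: sa)
  have diff_pow: "sa y \<Longrightarrow> sa z \<Longrightarrow> (W ^^ n) (y - z) = (W ^^ n) y - (W ^^ n) z" for n y z
    by (induction n) (auto simp: diff sa_pow)
  have sym_pow: "sa y \<Longrightarrow> sa z \<Longrightarrow> t ((W ^^ n) y * z) = t (y * (W ^^ n) z)" for n y z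
    by (induction n arbitrary: y) (auto simp: sym sa sa_pow funpow_swap1)
  have N_pow: "sa y \<Longrightarrow> N ((W ^^ n) y) \<le> N y" for n y
    by (induction n) (auto intro: order_trans contr sa_pow)
  define v where "v = W x - x"
  have v: "sa v" by (simp add: v_def sa x sa_intros)
  have pos_pow: "0 \<le> t ((W ^^ n) v * v)" for n
  \<comment> \<open>Symmetry splits the power evenly; for odd \<open>n\<close> one copy of
    \<open>W\<close> is left, and its positivity is used.\<close>
  proof (cases "even n")
    case True
    then obtain m where "n = m + m" by (metis evenE mult_2)
    then have "t ((W ^^ n) v * v) = t ((W ^^ m) v * (W ^^ m) v)"
      by (simp add: funpow_add sym_pow v sa_pow)
    then show ?thesis using t_sa_square(1)[OF sa_pow[OF v]] by simp
  next
    case False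
    then obtain m where n: "n = m + Suc m" by (metis oddE mult_2 add_Suc_right Suc_eq_plus1)
    have "t ((W ^^ n) v * v) = t ((W ^^ Suc m) v * (W ^^ m) v)"
      unfolding n funpow_add o_apply by (intro sym_pow sa_pow v)
    then show ?thesis using pos[OF sa_pow[OF v]] by simp
  qed
  define u where "u n = t ((W ^^ n) x * x)" for n
  obtain C where C: "\<And>z. sa z \<Longrightarrow> t (z * x) \<le> N z * C" using t_pairing_bound[OF x] by blast
  \<comment> \<open>Starting at index \<open>1\<close> yields \<open>W^2 \<le> W\<close> in the
    sense of the trace form; index \<open>0\<close> would give \<open>W \<le> 1\<close>.\<close>
  have "u (Suc 1) \<le> u 1"
  proof (rule convex_bounded_seq_decreasing)
    fix n
    have vpow: "(W ^^ m) v = (W ^^ Suc m) x - (W ^^ m) x" for m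
      by (simp add: v_def diff_pow sa x funpow_swap1)
    have "t ((W ^^ n) v * v) = t (W ((W ^^ n) v) * x) - t ((W ^^ n) v * x)"
      by (simp add: v_def right_diff_distrib t_diff sym sa_pow[OF v, unfolded v_def] x)
    also have "W ((W ^^ n) v) = (W ^^ Suc n) v" by simp
    finally have "t ((W ^^ n) v * v) = (u (Suc (Suc n)) - u (Suc n)) - (u (Suc n) - u n)"
      unfolding vpow u_def left_diff_distrib t_diff .
    then show "u (Suc n) - u n \<le> u (Suc (Suc n)) - u (Suc n)" using pos_pow[of n] by simp
  next
    fix n
    have "N ((W ^^ n) x) * C \<le> N x * \<bar>C\<bar>"
    proof -
      interpret normed_subspace "{h. sa h}" N by (rule normed_subspace_sa)
      have "N ((W ^^ n) x) * C \<le> N ((W ^^ n) x) * \<bar>C\<bar>"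
        using N_nonneg[of "(W ^^ n) x"] sa_pow[OF x] by (intro mult_left_mono) auto
      also have "\<dots> \<le> N x * \<bar>C\<bar>" by (intro mult_right_mono N_pow x) auto
      finally show ?thesis .
    qed
    then show "u n \<le> N x * \<bar>C\<bar>" unfolding u_def using C[OF sa_pow[OF x]] order_trans by blast
  qed
  then show ?thesis by (simp add: u_def sym sa x)
qed

text \<open>The preceding inequality gives \<open>W^2 \<le> W\<close>; for the inverse
  \<open>V\<close> at the vector \<open>W x\<close> it gives \<open>1 \<le> W\<close>. Together they
  make the form of \<open>W x - x\<close> with itself nonpositive.\<close>

lemma invertible_contractive_symmetric_eq_id:
  assumes sa: "\<And>x. sa x \<Longrightarrow> sa (W x)" "\<And>x. sa x \<Longrightarrow> sa (V x)"
    and diff: "\<And>x y. sa x \<Longrightarrow> sa y \<Longrightarrow> W (x - y) = W x - W y" "\<And>x y. sa x \<Longrightarrow> sa y \<Longrightarrow> V (x - y) = V x - V y"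
    and sym: "\<And>x y. sa x \<Longrightarrow> sa y \<Longrightarrow> t (W x * y) = t (x * W y)"
    and pos: "\<And>x. sa x \<Longrightarrow> 0 \<le> t (W x * x)"
    and contr: "\<And>x. sa x \<Longrightarrow> N (W x) \<le> N x" "\<And>x. sa x \<Longrightarrow> N (V x) \<le> N x"
    and inv: "\<And>x. sa x \<Longrightarrow> V (W x) = x" "\<And>x. sa x \<Longrightarrow> W (V x) = x"
    and x: "sa x"
  shows "W x = x"
proof -
  have 1: "t (W x * W x) \<le> t (W x * x)"
    by (rule contractive_symmetric_le[OF sa(1) diff(1) sym pos contr(1) x])
  have symV: "t (V y * z) = t (y * V z)" if "sa y" "sa z" for y z
    using sym[of "V y" "V z"] that sa inv by simp
  have posV: "0 \<le> t (V y * y)" if "sa y" for y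
    using pos[of "V y"] that sa inv t_commute[of y "V y"] by simp
  have "t (V (W x) * V (W x)) \<le> t (V (W x) * W x)"
    by (rule contractive_symmetric_le[OF sa(2) diff(2) symV posV contr(2) sa(1)[OF x]])
  then have 2: "t (x * x) \<le> t (W x * x)" using inv(1)[OF x] t_commute[of x "W x"] by simp
  have "t ((W x - x) * (W x - x)) = t (W x * W x) - 2 * t (W x * x) + t (x * x)"
    using t_commute[of x "W x"] by (simp add: algebra_simps t_diff t_add)
  then have "t ((W x - x) * (W x - x)) = 0"
    using 1 2 t_sa_square(1)[of "W x - x"] sa x by (simp add: sa_intros)
  then show ?thesis using t_sa_square(2)[of "W x - x"] sa x by (simp add: sa_intros)
qed

section \<open>Identities for twisted trace forms\<close>

lemma eqI_t:
  assumes "sa x" "sa y" "\<And>h. sa h \<Longrightarrow> t (x * h) = t (y * h)"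
  shows "x = y"
  using t_sa_square(2)[of "x - y"] assms by (simp add: sa_intros left_diff_distrib t_diff)

text \<open>Cyclicity matches the two integrands at every \<open>r\<close>. The identity moves a
  Hessian at \<open>- a\<close> to one at \<open>a\<close>, at the price of a conjugation.\<close>

lemma t_dexp_minus:
  "t (dexp (- a) x * y) = t (dexp a y * (exp (- a) * x * exp (- a)))"
proof -
  have "((\<lambda>r. t (exp ((1 - r) *\<^sub>R - a) * x * exp (r *\<^sub>R - a) * y)) has_integral t (dexp (- a) x * y)) {0..1}"
    using has_integral_linear[OF dexp_has_integral bounded_linear_compose[OF bounded_linear_t bounded_linear_mult_left[of y]], of "- a" x]
    by (simp add: o_def)
  moreover have "((\<lambda>r. t (exp ((1 - r) *\<^sub>R a) * y * exp (r *\<^sub>R a) * (exp (- a) * x * exp (- a))))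
      has_integral t (dexp a y * (exp (- a) * x * exp (- a)))) {0..1}"
    using has_integral_linear[OF dexp_has_integral bounded_linear_compose[OF bounded_linear_t bounded_linear_mult_left[of "exp (- a) * x * exp (- a)"]], of a y]
    by (simp add: o_def)
  moreover have "t (exp ((1 - r) *\<^sub>R - a) * x * exp (r *\<^sub>R - a) * y) =
      t (exp ((1 - r) *\<^sub>R a) * y * exp (r *\<^sub>R a) * (exp (- a) * x * exp (- a)))" for r
  proof -
    let ?e = "\<lambda>s. exp (s *\<^sub>R a)"
    have e: "?e (r - 1) = ?e r * ?e (- 1)" "?e (- r) = ?e (- 1) * ?e (1 - r)"
      using exp_scaleR_add[of r "- 1" a] exp_scaleR_add[of "- 1" "1 - r" a] by simp_all
    have "t (exp ((1 - r) *\<^sub>R - a) * x * exp (r *\<^sub>R - a) * y) = t (?e (r - 1) * x * ?e (- r) * y)"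
      by (simp add: algebra_simps)
    also have "\<dots> = t (?e r * (?e (- 1) * x * ?e (- 1) * ?e (1 - r) * y))"
      unfolding e by (simp only: mult.assoc)
    also have "\<dots> = t (?e (- 1) * x * ?e (- 1) * (?e (1 - r) * y * ?e r))"
      using t_commute[of "?e r" "?e (- 1) * x * ?e (- 1) * ?e (1 - r) * y"] by (simp add: mult.assoc)
    also have "\<dots> = t (?e (1 - r) * y * ?e r * (?e (- 1) * x * ?e (- 1)))" by (rule t_commute)
    finally show ?thesis by simp
  qed
  ultimately show ?thesis by (simp add: has_integral_unique)
qed

text \<open>With \<open>w = e\<^bsup>d/2\<^esup> g e\<^bsup>-d/2\<^esup>\<close> one has \<open>t (w\<^sup>* w) = t (e\<^bsup>d\<^esup> g e\<^bsup>-d\<^esup> g)\<close> and \<open>t (w w) = t (g g)\<close>,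
  so the difference is half the trace of \<open>(w - w\<^sup>*)\<^sup>* (w - w\<^sup>*)\<close>.\<close>

lemma t_exp_twist:
  assumes "sa d" "sa g"
  shows "t (g * g) \<le> t (exp d * g * exp (- d) * g)"
    "t (g * g) = t (exp d * g * exp (- d) * g) \<Longrightarrow> d * g = g * d"
proof -
  define p where "p = exp ((1/2) *\<^sub>R d)"
  define q where "q = exp ((- 1/2) *\<^sub>R d)"
  have pq: "p * q = 1" "q * p = 1" "p * (q * y) = y" "q * (p * y) = y" for y
    unfolding p_def q_def by (rule exp_scaleR_cancel; simp)+
  have pp: "exp d = p * p" "exp (- d) = q * q"
    unfolding p_def q_def exp_scaleR_add[symmetric] by simp_all
  have sa: "sa p" "sa q" using assms by (simp_all add: p_def q_def sa_intros)
  define w where "w = p * g * q"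
  have w': "st w = q * g * p" by (simp add: w_def st_mult sa assms mult.assoc)
  have 1: "t (w * w) = t (g * g)" using t_commute[of p "g * g * q"] by (simp add: w_def mult.assoc pq)
  have 2: "t (st w * st w) = t (g * g)" using t_commute[of q "g * g * p"] by (simp add: w' mult.assoc pq)
  have 3: "t (st w * w) = t (exp d * g * exp (- d) * g)"
    using t_commute[of "q * g" "p * (p * (g * q))"] t_commute[of "p * (p * (g * (q * q)))" g]
    unfolding w' pp unfolding w_def by (simp add: mult.assoc)
  have 4: "t (w * st w) = t (st w * w)" by (rule t_commute)
  have "t (st (w - st w) * (w - st w)) = t (st w * w) + t (w * st w) - t (w * w) - t (st w * st w)"
    by (simp add: st_diff st_st algebra_simps t_diff t_add)
  then have 5: "t (st (w - st w) * (w - st w)) = 2 * (t (exp d * g * exp (- d) * g) - t (g * g))"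
    using 1 2 3 4 by simp
  then show "t (g * g) \<le> t (exp d * g * exp (- d) * g)" using t_square_nonneg[of "w - st w"] by simp
  assume "t (g * g) = t (exp d * g * exp (- d) * g)"
  then have "w = st w" using 5 t_square_eq_0[of "w - st w"] by simp
  then have "p * (p * g * q) * p = p * (q * g * p) * p" unfolding w' by (simp add: w_def)
  then have "exp d * g = g * exp d" by (simp add: pp mult.assoc pq)
  then show "d * g = g * d" by (rule exp_intertwine[OF assms(1) assms(1)])
qed

end

section \<open>Trace identities for a linear bijection of the self-adjoint parts\<close>

text \<open>The inverse \<open>K\<close> is a parameter, which makes the setting symmetric:
  exchanging the algebras yields another instance.\<close>

locale trace_pair = A: tracial scA stA \<tau> + B: tracial scB stB \<omega>
  for scA :: "complex \<Rightarrow> 'a::{real_normed_algebra_1,banach} \<Rightarrow> 'a" and stA :: "'a \<Rightarrow> 'a" and \<tau> :: "'a \<Rightarrow> complex"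
    and scB :: "complex \<Rightarrow> 'b::{real_normed_algebra_1,banach} \<Rightarrow> 'b" and stB :: "'b \<Rightarrow> 'b" and \<omega> :: "'b \<Rightarrow> complex" +
  fixes L :: "'a \<Rightarrow> 'b" and K :: "'b \<Rightarrow> 'a" and c :: 'b and k :: real
  assumes L_sa: "A.sa x \<Longrightarrow> B.sa (L x)" and K_sa: "B.sa y \<Longrightarrow> A.sa (K y)"
    and KL: "A.sa x \<Longrightarrow> K (L x) = x" and LK: "B.sa y \<Longrightarrow> L (K y) = y"
    and L_add: "A.sa x \<Longrightarrow> A.sa x' \<Longrightarrow> L (x + x') = L x + L x'"
    and L_scaleR: "A.sa x \<Longrightarrow> L (r *\<^sub>R x) = r *\<^sub>R L x"
    and c_sa: "B.sa c" and k_pos: "0 < k"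
    and trace_exp: "A.sa x \<Longrightarrow> B.t (exp (c + L x)) = k * A.t (exp x)"
begin

lemma L_diff: "A.sa x \<Longrightarrow> A.sa y \<Longrightarrow> L (x - y) = L x - L y"
  using L_add[of x "-1 *\<^sub>R y"] L_scaleR[of y "-1"] by (simp add: A.sa_intros)

lemma K_add: "B.sa x \<Longrightarrow> B.sa y \<Longrightarrow> K (x + y) = K x + K y"
  using KL[of "K x + K y"] by (simp add: L_add K_sa LK A.sa_intros)

lemma K_scaleR: "B.sa x \<Longrightarrow> K (r *\<^sub>R x) = r *\<^sub>R K x"
  using KL[of "r *\<^sub>R K x"] by (simp add: L_scaleR K_sa LK A.sa_intros)

lemma K_diff: "B.sa x \<Longrightarrow> B.sa y \<Longrightarrow> K (x - y) = K x - K y"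
  using KL[of "K x - K y"] by (simp add: L_diff K_sa LK A.sa_intros)

lemma trace_gradient:
  assumes "A.sa x" "A.sa h"
  shows "B.t (exp (c + L x) * L h) = k * A.t (exp x * h)"
proof -
  have eq: "B.t (exp (c + L x + s *\<^sub>R L h)) = k * A.t (exp (x + s *\<^sub>R h))" for s
    using trace_exp[of "x + s *\<^sub>R h"] assms by (simp add: L_add L_scaleR A.sa_intros add.assoc)
  have "((\<lambda>s. k * A.t (exp (x + s *\<^sub>R h))) has_real_derivative B.t (exp (c + L x) * L h)) (at 0)"
    using B.t_exp_line_derivative_one[of "c + L x" "L h" 0] unfolding eq by simp
  moreover have "((\<lambda>s. k * A.t (exp (x + s *\<^sub>R h))) has_real_derivative k * A.t (exp x * h)) (at 0)"
    using DERIV_cmult[OF A.t_exp_line_derivative_one[of x h 0], of k] by simp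
  ultimately show ?thesis by (rule DERIV_unique)
qed

lemma trace_Hessian:
  assumes "A.sa x" "A.sa g" "A.sa h"
  shows "B.t (dexp (c + L x) (L g) * L h) = k * A.t (dexp x g * h)"
proof -
  have eq: "B.t (exp (c + L x + s *\<^sub>R L g) * L h) = k * A.t (exp (x + s *\<^sub>R g) * h)" for s
    using trace_gradient[of "x + s *\<^sub>R g" h] assms by (simp add: L_add L_scaleR A.sa_intros add.assoc)
  have "((\<lambda>s. k * A.t (exp (x + s *\<^sub>R g) * h)) has_real_derivative B.t (dexp (c + L x) (L g) * L h)) (at 0)"
    using B.t_exp_line_derivative[of "c + L x" "L g" "L h" 0] unfolding eq by simp
  moreover have "((\<lambda>s. k * A.t (exp (x + s *\<^sub>R g) * h)) has_real_derivative k * A.t (dexp x g * h)) (at 0)"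
    using DERIV_cmult[OF A.t_exp_line_derivative[of x g h 0], of k] by simp
  ultimately show ?thesis by (rule DERIV_unique)
qed

lemma L_zero: "L 0 = 0"
  using L_scaleR[of 0 0] by simp

text \<open>The Hessian identity at \<open>0\<close>: \<open>L\<close> carries the trace form of the
  first algebra, up to \<open>k\<close>, to the form twisted by \<open>dexp c\<close>.\<close>

lemma trace_form:
  assumes "A.sa g" "A.sa h"
  shows "B.t (dexp c (L g) * L h) = k * A.t (g * h)"
  using trace_Hessian[of 0 g h] assms by (simp add: L_zero dexp_commuting)

lemma trace_form_K:
  assumes "B.sa x" "B.sa y"
  shows "B.t (dexp c x * y) = k * A.t (K x * K y)"
  using trace_form[of "K x" "K y"] assms by (simp add: K_sa LK)

section \<open>The element \<open>d\<close>, its exponentials and the order\<close>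

definition d :: 'a where "d = K c"

lemma d_sa: "A.sa d"
  by (simp add: d_def K_sa c_sa)

lemma L_d: "L (s *\<^sub>R d) = s *\<^sub>R c"
  by (simp add: d_def L_scaleR K_sa LK c_sa)

text \<open>At \<open>s d\<close> the gradient identity involves \<open>exp ((1 + s) c)\<close>,
  which equals \<open>dexp c (exp (s c))\<close> as the arguments commute. Comparison with the
  twisted form identifies the preimage.\<close>

lemma K_exp: "K (exp (s *\<^sub>R c)) = exp (s *\<^sub>R d)"
proof (rule A.eqI_t)
  have c: "B.sa (exp (s *\<^sub>R c))" by (simp add: B.sa_intros c_sa)
  then show "A.sa (K (exp (s *\<^sub>R c)))" by (rule K_sa)
  show "A.sa (exp (s *\<^sub>R d))" by (simp add: A.sa_intros d_sa)
  fix h assume h: "A.sa h"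
  have "k * A.t (exp (s *\<^sub>R d) * h) = B.t (exp (c + s *\<^sub>R c) * L h)"
    using trace_gradient[of "s *\<^sub>R d" h] h by (simp add: A.sa_intros d_sa L_d)
  also have "exp (c + s *\<^sub>R c) = dexp c (exp (s *\<^sub>R c))"
    using dexp_commuting[of c "exp (s *\<^sub>R c)"] exp_commute[of "s *\<^sub>R c" c]
    by (simp add: exp_add_commuting)
  also have "B.t (\<dots> * L h) = k * A.t (K (exp (s *\<^sub>R c)) * h)"
    using trace_form_K[OF c, of "L h"] h by (simp add: L_sa KL)
  finally show "A.t (K (exp (s *\<^sub>R c)) * h) = A.t (exp (s *\<^sub>R d) * h)" using k_pos by simp
qed

lemma L_exp_d: "L (exp (s *\<^sub>R d)) = exp (s *\<^sub>R c)"
  using LK[of "exp (s *\<^sub>R c)"] by (simp add: K_exp B.sa_intros c_sa)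

lemma L_one: "L 1 = 1"
  using L_exp_d[of 0] by simp

text \<open>Every self-adjoint \<open>u\<close> has the form \<open>c + L x\<close>, so the gradient
  identity translates the tests on one side into those on the other.\<close>

lemma tpos_L: "A.sa h \<Longrightarrow> B.tpos (L h) \<longleftrightarrow> A.tpos h"
proof -
  assume h: "A.sa h"
  have "B.tpos (L h) \<longleftrightarrow> (\<forall>x. A.sa x \<longrightarrow> 0 \<le> B.t (exp (c + L x) * L h))"
    unfolding B.tpos_def
  proof (intro iffI allI impI)
    fix u assume *: "\<forall>x. A.sa x \<longrightarrow> 0 \<le> B.t (exp (c + L x) * L h)" "B.sa u"
    then show "0 \<le> B.t (exp u * L h)"
      using *(1)[rule_format, of "K (u - c)"] by (simp add: K_sa LK B.sa_intros c_sa)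
  qed (simp add: B.sa_intros L_sa c_sa)
  then show ?thesis using h k_pos by (simp add: trace_gradient A.tpos_def zero_le_mult_iff)
qed

section \<open>Two conjugation groups on the self-adjoint part and their comparison\<close>

definition P :: "real \<Rightarrow> 'a \<Rightarrow> 'a" where
  "P s x = exp (s *\<^sub>R d) * x * exp (s *\<^sub>R d)"

definition Q :: "real \<Rightarrow> 'a \<Rightarrow> 'a" where
  "Q s x = K (exp (s *\<^sub>R c) * L x * exp (s *\<^sub>R c))"

lemma P_sa: "A.sa x \<Longrightarrow> A.sa (P s x)"
  by (simp add: P_def A.sa_intros d_sa)

lemma Q_arg_sa: "A.sa x \<Longrightarrow> B.sa (exp (s *\<^sub>R c) * L x * exp (s *\<^sub>R c))"
  by (simp add: B.sa_intros c_sa L_sa)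

lemma Q_sa: "A.sa x \<Longrightarrow> A.sa (Q s x)"
  by (simp add: Q_def K_sa Q_arg_sa)

lemma L_Q: "A.sa x \<Longrightarrow> L (Q s x) = exp (s *\<^sub>R c) * L x * exp (s *\<^sub>R c)"
  by (simp add: Q_def LK Q_arg_sa)

lemma P_add: "P s (P r x) = P (s + r) x"
proof -
  have "P s (P r x) = (exp (s *\<^sub>R d) * exp (r *\<^sub>R d)) * x * (exp (r *\<^sub>R d) * exp (s *\<^sub>R d))"
    by (simp add: P_def mult.assoc)
  then show ?thesis unfolding exp_scaleR_add[symmetric] by (simp add: P_def add.commute)
qed

lemma Q_add:
  assumes "A.sa x"
  shows "Q s (Q r x) = Q (s + r) x"
proof -
  have "Q s (Q r x) = K ((exp (s *\<^sub>R c) * exp (r *\<^sub>R c)) * L x * (exp (r *\<^sub>R c) * exp (s *\<^sub>R c)))"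
    unfolding Q_def[of s] L_Q[OF assms] by (simp add: mult.assoc)
  then show ?thesis unfolding exp_scaleR_add[symmetric] by (simp add: Q_def add.commute)
qed

lemma P_zero: "P 0 x = x" and Q_zero: "A.sa x \<Longrightarrow> Q 0 x = x"
  by (simp_all add: P_def Q_def KL)

lemma P_diff: "P s (x - y) = P s x - P s y"
  by (simp add: P_def algebra_simps)

lemma Q_diff: "A.sa x \<Longrightarrow> A.sa y \<Longrightarrow> Q s (x - y) = Q s x - Q s y"
  using K_diff[OF Q_arg_sa Q_arg_sa, of x y s s] by (simp add: Q_def L_diff algebra_simps)

lemma P_scaleR: "P s (r *\<^sub>R x) = r *\<^sub>R P s x"
  by (simp add: P_def)

lemma Q_scaleR: "A.sa x \<Longrightarrow> Q s (r *\<^sub>R x) = r *\<^sub>R Q s x"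
  using K_scaleR[OF Q_arg_sa, of x r s] by (simp add: Q_def L_scaleR)

lemma P_sym: "A.t (P s x * y) = A.t (x * P s y)"
  using A.t_commute[of "exp (s *\<^sub>R d)" "x * exp (s *\<^sub>R d) * y"] by (simp add: P_def mult.assoc)

lemma dexp_conj:
  "dexp c (exp (s *\<^sub>R c) * x * exp (s *\<^sub>R c)) = exp (s *\<^sub>R c) * dexp c x * exp (s *\<^sub>R c)"
proof (rule dexp_bounded_linear_commute)
  show "bounded_linear (\<lambda>x. exp (s *\<^sub>R c) * x * exp (s *\<^sub>R c))"
    using bounded_linear_compose[OF bounded_linear_mult_left bounded_linear_mult_right] by blast
  fix r
  let ?e = "\<lambda>s. exp (s *\<^sub>R c)"
  have "?e (1 - r) * (?e s * x * ?e s) * ?e r = (?e (1 - r) * ?e s) * x * (?e s * ?e r)"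
    by (simp only: mult.assoc)
  also have "\<dots> = (?e s * ?e (1 - r)) * x * (?e r * ?e s)"
    unfolding exp_scaleR_add[symmetric] by (simp only: add.commute)
  also have "\<dots> = ?e s * (?e (1 - r) * x * ?e r) * ?e s" by (simp only: mult.assoc)
  finally show "?e (1 - r) * (?e s * x * ?e s) * ?e r = ?e s * (?e (1 - r) * x * ?e r) * ?e s" .
qed

text \<open>Conjugation by \<open>exp (s c)\<close> commutes with \<open>dexp c\<close> and is
  symmetric under the trace, hence symmetric for the twisted form.\<close>

lemma Q_sym:
  assumes "A.sa x" "A.sa y"
  shows "A.t (Q s x * y) = A.t (x * Q s y)"
proof -
  let ?e = "exp (s *\<^sub>R c)"
  have "k * A.t (Q s x * y) = B.t (dexp c (?e * L x * ?e) * L y)"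
    using trace_form[of "Q s x" y] assms by (simp add: Q_sa L_Q)
  also have "\<dots> = B.t (?e * (dexp c (L x) * ?e * L y))" unfolding dexp_conj by (simp add: mult.assoc)
  also have "\<dots> = B.t (dexp c (L x) * (?e * L y * ?e))"
    using B.t_commute[of ?e "dexp c (L x) * ?e * L y"] by (simp add: mult.assoc)
  also have "\<dots> = k * A.t (x * Q s y)"
    using trace_form[of x "Q s y"] assms by (simp add: Q_sa L_Q)
  finally show ?thesis using k_pos by simp
qed

lemma tpos_P: "A.tpos x \<Longrightarrow> A.tpos (P s x)"
  unfolding P_def by (rule A.tpos_conj) (simp_all add: A.sa_intros d_sa)

lemma tpos_Q: "A.sa x \<Longrightarrow> A.tpos x \<Longrightarrow> A.tpos (Q s x)"
  using tpos_L[of "Q s x"] tpos_L[of x] B.tpos_conj[of "L x" "s *\<^sub>R c"]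
  by (simp add: Q_sa L_Q B.sa_intros c_sa)

text \<open>Placing half of \<open>Q (- s)\<close> on each side of \<open>P s\<close> keeps
  \<open>W s\<close> symmetric and positive for the trace form.\<close>

definition W :: "real \<Rightarrow> 'a \<Rightarrow> 'a" where
  "W s x = Q (- s/2) (P s (Q (- s/2) x))"

lemma W_sa: "A.sa x \<Longrightarrow> A.sa (W s x)"
  by (simp add: W_def Q_sa P_sa)

lemma W_diff: "A.sa x \<Longrightarrow> A.sa y \<Longrightarrow> W s (x - y) = W s x - W s y"
  by (simp add: W_def Q_sa P_sa Q_diff P_diff)

lemma W_scaleR: "A.sa x \<Longrightarrow> W s (r *\<^sub>R x) = r *\<^sub>R W s x"
  by (simp add: W_def Q_sa P_sa Q_scaleR P_scaleR)

lemma W_one: "W s 1 = 1"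
proof -
  have e: "exp ((- s/2) *\<^sub>R c) * exp ((- s/2) *\<^sub>R c) = exp ((- s) *\<^sub>R c)"
    unfolding exp_scaleR_add[symmetric] by simp
  have "Q (- s/2) 1 = exp ((- s) *\<^sub>R d)" by (simp only: Q_def L_one mult_1_right e K_exp)
  moreover have "P s (exp ((- s) *\<^sub>R d)) = exp (s *\<^sub>R d)"
    unfolding P_def by (simp only: exp_scaleR_add[symmetric]) simp
  moreover have "Q (- s/2) (exp (s *\<^sub>R d)) = 1"
    unfolding Q_def L_exp_d by (simp only: exp_scaleR_add[symmetric]) (use K_exp[of 0] in simp)
  ultimately show ?thesis by (simp add: W_def)
qed

lemma tpos_W: "A.sa x \<Longrightarrow> A.tpos x \<Longrightarrow> A.tpos (W s x)"
  by (simp add: W_def tpos_Q tpos_P Q_sa P_sa)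

text \<open>\<open>N\<close> is the order-unit norm of \<open>tpos\<close>, so a linear map that is
  unital and preserves \<open>tpos\<close> cannot increase it.\<close>

lemma N_W_le:
  assumes x: "A.sa x"
  shows "A.N (W s x) \<le> A.N x"
proof -
  have *: "A.tpos (r *\<^sub>R 1 - W s y)" if "A.tpos (r *\<^sub>R 1 - y)" "A.sa y" for r y
    using tpos_W[OF _ that(1), of s] W_diff[of "r *\<^sub>R 1" y s] W_scaleR[of 1 s r] that
    by (simp add: W_one A.sa_intros)
  have m: "W s (- x) = - W s x" using W_scaleR[OF x, of s "-1"] by simp
  have "A.tpos (A.N x *\<^sub>R 1 - x)" "A.tpos (A.N x *\<^sub>R 1 - (- x))"
    using A.N_le_iff_tpos[OF x, of "A.N x"] by simp_all
  then have "A.tpos (A.N x *\<^sub>R 1 - W s x)" "A.tpos (A.N x *\<^sub>R 1 - W s (- x))"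
    using * x by (simp_all add: A.sa_intros)
  then show ?thesis using A.N_le_iff_tpos[OF W_sa[OF x]] by (simp add: m)
qed

lemma W_inverse:
  assumes "A.sa x"
  shows "W (- s) (W s x) = x"
  using assms by (simp add: W_def Q_add P_add Q_sa P_sa Q_zero P_zero)

lemma W_eq_id:
  assumes "A.sa x"
  shows "W s x = x"
proof (rule A.invertible_contractive_symmetric_eq_id[where W = "W s" and V = "W (- s)"])
  show "W s (W (- s) y) = y" if "A.sa y" for y using W_inverse[OF that, of "- s"] by simp
  show "A.t (W s x * y) = A.t (x * W s y)" if "A.sa x" "A.sa y" for x y
    using that by (simp add: W_def Q_sym P_sym Q_sa P_sa)
  show "0 \<le> A.t (W s y * y)" if "A.sa y" for y
  proof -
    \<comment> \<open>This displays \<open>W s\<close> as the adjoint of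
      \<open>P (s/2) Q (- s/2)\<close> composed with that operator.\<close>
    let ?z = "P (s/2) (Q (- s/2) y)"
    have "A.t (W s y * y) = A.t (P (s/2) ?z * Q (- s/2) y)"
      using that by (simp add: W_def Q_sym Q_sa P_sa P_add)
    also have "\<dots> = A.t (?z * ?z)" by (rule P_sym)
    finally show ?thesis using A.t_sa_square(1)[of ?z] that by (simp add: P_sa Q_sa)
  qed
qed (assumption | rule W_sa W_diff N_W_le W_inverse assms)+

lemma P_eq_Q:
  assumes "A.sa x"
  shows "P s x = Q s x"
proof -
  have "Q (s/2) (W s (Q (s/2) x)) = Q (s/2) (Q (s/2) x)" using assms by (simp add: W_eq_id Q_sa)
  then show ?thesis using assms by (simp add: W_def Q_add P_add Q_sa P_sa Q_zero)
qed

text \<open>The Hessian at \<open>- 2d\<close> reduces to the form at \<open>c\<close>, and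
  \<open>P = Q\<close> evaluates it as \<open>t (g * g)\<close>. Hence the twisted forms of
  \<open>g\<close> average to the untwisted one; none is smaller, so all agree, and equality means
  commutation.\<close>

lemma d_commutes:
  assumes g: "A.sa g"
  shows "d * g = g * d"
proof -
  \<comment> \<open>The conjugation by \<open>exp d\<close> recentres the exponents in the
    integrand, turning them into \<open>2r - 1\<close> and \<open>1 - 2r\<close>.\<close>
  let ?h = "P 1 g"
  have h: "A.sa ?h" by (simp add: P_sa g)
  have "k * A.t (dexp (- (2 *\<^sub>R d)) g * ?h) = B.t (dexp (c + L (- (2 *\<^sub>R d))) (L g) * L ?h)"
    by (rule trace_Hessian[symmetric]) (use g h d_sa in \<open>simp_all add: A.sa_intros\<close>)
  also have "c + L (- (2 *\<^sub>R d)) = - c" using L_d[of "-2"] by (simp add: scaleR_2)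
  also have "B.t (dexp (- c) (L g) * L ?h) = B.t (dexp c (L ?h) * L (Q (-1) g))"
    unfolding B.t_dexp_minus using L_Q[OF g, of "-1"] by simp
  also have "\<dots> = k * A.t (?h * P (-1) g)"
    using trace_form[OF h Q_sa[OF g]] by (simp add: P_eq_Q g)
  also have "A.t (?h * P (-1) g) = A.t (g * g)" by (simp add: P_sym P_add P_zero)
  finally have eq: "A.t (dexp (- (2 *\<^sub>R d)) g * ?h) = A.t (g * g)" using k_pos by simp
  let ?j = "\<lambda>r. A.t (exp ((2 * r - 1) *\<^sub>R d) * g * exp (- ((2 * r - 1) *\<^sub>R d)) * g)"
  have j: "A.t (exp ((1 - r) *\<^sub>R - (2 *\<^sub>R d)) * g * exp (r *\<^sub>R - (2 *\<^sub>R d)) * ?h) = ?j r" for r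
  proof -
    let ?e = "\<lambda>s. exp (s *\<^sub>R d)"
    have e: "?e (2 * r - 1) = ?e 1 * ?e (2 * r - 2)" "?e (1 - 2 * r) = ?e (- 2 * r) * ?e 1"
      unfolding exp_scaleR_add[symmetric] by simp_all
    have "A.t (exp ((1 - r) *\<^sub>R - (2 *\<^sub>R d)) * g * exp (r *\<^sub>R - (2 *\<^sub>R d)) * ?h)
        = A.t (?e (2 * r - 2) * g * ?e (- 2 * r) * ?e 1 * g * ?e 1)"
      by (simp add: P_def algebra_simps)
    also have "\<dots> = A.t (?e 1 * (?e (2 * r - 2) * g * ?e (- 2 * r) * ?e 1 * g))" by (rule A.t_commute)
    also have "\<dots> = A.t (?e (2 * r - 1) * g * ?e (1 - 2 * r) * g)" unfolding e by (simp only: mult.assoc)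
    also have "(1 - 2 * r) *\<^sub>R d = - ((2 * r - 1) *\<^sub>R d)" by (simp add: algebra_simps)
    finally show ?thesis .
  qed
  have "(?j has_integral A.t (g * g)) {0..1}"
    using has_integral_linear[OF dexp_has_integral bounded_linear_compose[OF A.bounded_linear_t bounded_linear_mult_left[of ?h]], of "- (2 *\<^sub>R d)" g]
    unfolding o_def j eq .
  then have "((\<lambda>r. ?j r - A.t (g * g)) has_integral (A.t (g * g) - A.t (g * g))) {0..1}"
    by (rule has_integral_diff) (use has_integral_const_real[of "A.t (g * g)" 0 1] in simp)
  then have int0: "integral {0..1} (\<lambda>r. ?j r - A.t (g * g)) = 0" by (simp add: has_integral_iff)
  have cont: "continuous_on {0..1} (\<lambda>r. ?j r - A.t (g * g))"
    unfolding scaleR_minus_left[symmetric]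
    by (intro continuous_intros A.continuous_on_t continuous_on_exp_compose_scaleR)
  have nn: "0 \<le> ?j r - A.t (g * g)" for r
    using A.t_exp_twist(1)[of "(2 * r - 1) *\<^sub>R d" g] g d_sa by (simp add: A.sa_intros)
  have "\<forall>r\<in>{0..1}. ?j r - A.t (g * g) = 0"
    using integral_eq_0_iff[OF cont _ nn] int0 by simp
  \<comment> \<open>At \<open>r = 1\<close> the twist is by \<open>d\<close> itself.\<close>
  then have "?j 1 - A.t (g * g) = 0" by (rule bspec) simp
  then show ?thesis using A.t_exp_twist(2)[OF d_sa g] by simp
qed

end

section \<open>Centrality of \<open>c\<close> and multiplicative properties of
  \<open>L\<close>\<close>

context trace_pair
begin

lemma trace_pair_swap: "trace_pair scB stB \<omega> scA stA \<tau> K L (- d) (1/k)"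
proof unfold_locales
  fix y assume y: "B.sa y"
  show "A.t (exp (- d + K y)) = 1 / k * B.t (exp y)"
    \<comment> \<open>At \<open>- d + K y\<close> the shift cancels, as
      \<open>L d = c\<close>.\<close>
    using trace_exp[of "- d + K y"] y k_pos LK[OF c_sa]
    by (simp add: A.sa_intros d_sa K_sa L_diff LK d_def c_sa)
qed (simp_all add: L_sa K_sa KL LK K_add K_scaleR A.sa_intros d_sa k_pos)

text \<open>In the exchanged setting the role of \<open>d\<close> is played by
  \<open>L (- d) = - c\<close>.\<close>

lemma c_commutes: "c * y = y * c"
proof (rule B.commute_of_sa)
  interpret S: trace_pair scB stB \<omega> scA stA \<tau> K L "- d" "1/k" by (rule trace_pair_swap)
  fix g assume "B.sa g"
  then have "S.d * g = g * S.d" by (rule S.d_commutes)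
  moreover have "S.d = - c" using L_d[of "-1"] by (simp add: S.d_def)
  ultimately show "c * g = g * c" by simp
qed

lemma trace_weighted:
  assumes "A.sa g" "A.sa h"
  shows "B.t (exp c * L g * L h) = k * A.t (g * h)"
  using trace_form[OF assms] by (simp add: dexp_commuting c_commutes)

text \<open>Surjectivity of \<open>L\<close> allows the test element \<open>x - y\<close>, and the
  trace weighted by \<open>exp c\<close> is still faithful.\<close>

lemma eqI_weighted:
  assumes "B.sa x" "B.sa y" "\<And>h. A.sa h \<Longrightarrow> B.t (exp c * x * L h) = B.t (exp c * y * L h)"
  shows "x = y"
proof -
  have sa: "B.sa (x - y)" using assms by (simp add: B.sa_intros)
  have "B.t (exp c * x * L (K (x - y))) = B.t (exp c * y * L (K (x - y)))"
    by (rule assms(3)) (rule K_sa[OF sa])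
  then have "B.t (exp c * (x - y) * exp 0 * stB (x - y)) = 0"
    using sa by (simp add: LK left_diff_distrib right_diff_distrib B.t_diff)
  then have "x - y = 0" using B.t_exp_conj_nonneg(2)[OF c_sa B.sa_intros(1)] by blast
  then show ?thesis by simp
qed

lemma L_exp:
  assumes "A.sa x"
  shows "L (exp x) = exp (L x)"
proof (rule eqI_weighted)
  fix h assume h: "A.sa h"
  have "B.t (exp c * L (exp x) * L h) = k * A.t (exp x * h)"
    by (rule trace_weighted) (simp_all add: assms h A.sa_intros)
  also have "\<dots> = B.t (exp (c + L x) * L h)" using trace_gradient assms h by simp
  finally show "B.t (exp c * L (exp x) * L h) = B.t (exp c * exp (L x) * L h)"
    by (simp add: exp_add_commuting c_commutes)
qed (simp_all add: A.sa_intros B.sa_intros L_sa assms)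

text \<open>The gradient identity along the ray \<open>s x\<close> is differentiated twice. Since
  \<open>x\<close> commutes with \<open>exp (s x)\<close>, each derivative brings down a factor
  \<open>x\<close> on one side and \<open>L x\<close> on the other.\<close>

lemma L_square:
  assumes x: "A.sa x"
  shows "L (x * x) = L x * L x"
proof (rule eqI_weighted)
  fix h assume h: "A.sa h"
  have c: "exp c * y = y * exp c" for y by (rule exp_commute) (rule c_commutes)
  have eq: "B.t (exp (0 + s *\<^sub>R L x) * (L h * exp c)) = k * A.t (exp (0 + s *\<^sub>R x) * h)" for s
    using trace_gradient[of "s *\<^sub>R x" h] x h B.t_commute[of "exp c" "exp (s *\<^sub>R L x) * L h"]
    by (simp add: A.sa_intros L_scaleR exp_add_commuting c_commutes mult.assoc)
  have comm: "(s *\<^sub>R a) * a = a * (s *\<^sub>R a)" for s and a :: "'z::real_normed_algebra" by simp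
  have eq2: "B.t (exp (0 + s *\<^sub>R L x) * (L x * (L h * exp c))) = k * A.t (exp (0 + s *\<^sub>R x) * (x * h))" for s
  proof -
    have "((\<lambda>s. k * A.t (exp (0 + s *\<^sub>R x) * h)) has_real_derivative B.t (dexp (0 + s *\<^sub>R L x) (L x) * (L h * exp c))) (at s)"
      using B.t_exp_line_derivative[of 0 "L x" "L h * exp c" s] unfolding eq .
    moreover have "((\<lambda>s. k * A.t (exp (0 + s *\<^sub>R x) * h)) has_real_derivative k * A.t (dexp (0 + s *\<^sub>R x) x * h)) (at s)"
      by (rule DERIV_cmult[OF A.t_exp_line_derivative])
    ultimately have "B.t (dexp (0 + s *\<^sub>R L x) (L x) * (L h * exp c)) = k * A.t (dexp (0 + s *\<^sub>R x) x * h)"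
      by (rule DERIV_unique)
    then show ?thesis by (simp add: dexp_commuting mult.assoc)
  qed
  have "((\<lambda>s. k * A.t (exp (0 + s *\<^sub>R x) * (x * h))) has_real_derivative B.t (dexp (0 + 0 *\<^sub>R L x) (L x) * (L x * (L h * exp c)))) (at 0)"
    using B.t_exp_line_derivative[of 0 "L x" "L x * (L h * exp c)" 0] unfolding eq2 .
  moreover have "((\<lambda>s. k * A.t (exp (0 + s *\<^sub>R x) * (x * h))) has_real_derivative k * A.t (dexp (0 + 0 *\<^sub>R x) x * (x * h))) (at 0)"
    by (rule DERIV_cmult[OF A.t_exp_line_derivative])
  ultimately have "B.t (dexp (0 + 0 *\<^sub>R L x) (L x) * (L x * (L h * exp c))) = k * A.t (dexp (0 + 0 *\<^sub>R x) x * (x * h))"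
    by (rule DERIV_unique)
  then have "B.t (L x * (L x * (L h * exp c))) = k * A.t (x * (x * h))"
    by (simp add: dexp_commuting)
  moreover have "B.t (exp c * L (x * x) * L h) = k * A.t (x * x * h)"
    by (rule trace_weighted) (simp_all add: x h A.sa_intros)
  ultimately show "B.t (exp c * L (x * x) * L h) = B.t (exp c * (L x * L x) * L h)"
    using B.t_commute[of "exp c" "L x * (L x * L h)"] by (simp add: mult.assoc)
qed (simp_all add: A.sa_intros B.sa_intros L_sa x)

section \<open>The Jordan *-isomorphism obtained from \<open>L\<close>\<close>

lemma L_jordan:
  assumes "A.sa x" "A.sa y"
  shows "L (x * y + y * x) = L x * L y + L y * L x"
proof -
  have "x * y + y * x = (x + y) * (x + y) - x * x - y * y" by (simp add: algebra_simps)
  then have "L (x * y + y * x) = L ((x + y) * (x + y)) - L (x * x) - L (y * y)"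
    using assms by (simp add: L_diff A.sa_intros)
  then show ?thesis using assms by (simp add: L_square L_add A.sa_intros) (simp add: algebra_simps)
qed

text \<open>The complex-linear extension of \<open>L\<close>, applied separately to the real and
  imaginary parts of \<open>x\<close>.\<close>

definition J :: "'a \<Rightarrow> 'b" where
  "J x = L ((1/2) *\<^sub>R (x + stA x)) + scB \<i> (L ((1/2) *\<^sub>R scA \<i> (stA x - x)))"

lemma J_decomp:
  assumes "A.sa h" "A.sa g"
  shows "J (h + scA \<i> g) = L h + scB \<i> (L g)"
proof -
  have "(1/2) *\<^sub>R ((h + scA \<i> g) + stA (h + scA \<i> g)) = h"
    using assms by (simp add: A.st_add A.st_sc A.sc_uminus flip: scaleR_add_left)
  moreover have "(1/2) *\<^sub>R scA \<i> (stA (h + scA \<i> g) - (h + scA \<i> g)) = g"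
    using assms by (simp add: A.st_add A.st_sc A.sc_uminus A.sc_diff A.sc_minus A.sc_i_i flip: scaleR_add_left)
  ultimately show ?thesis by (simp add: J_def)
qed

lemma J_sa: "A.sa x \<Longrightarrow> J x = L x"
  using J_decomp[of x 0] by (simp add: L_zero)

lemma J_add: "J (x + y) = J x + J y"
proof -
  obtain h k where x: "A.sa h" "A.sa k" "x = h + scA \<i> k" by (rule A.sa_decomp)
  obtain h' k' where y: "A.sa h'" "A.sa k'" "y = h' + scA \<i> k'" by (rule A.sa_decomp)
  have xy: "x + y = (h + h') + scA \<i> (k + k')" by (simp add: x y A.sc_add)
  have "J (x + y) = L (h + h') + scB \<i> (L (k + k'))"
    unfolding xy by (rule J_decomp) (use x y in \<open>simp_all add: A.sa_intros\<close>)
  also have "\<dots> = J x + J y" using x y by (simp add: J_decomp L_add B.sc_add)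
  finally show ?thesis .
qed

lemma J_scA: "J (scA a x) = scB a (J x)"
proof -
  obtain h k where x: "A.sa h" "A.sa k" "x = h + scA \<i> k" by (rule A.sa_decomp)
  have ax: "scA a x = (Re a *\<^sub>R h - Im a *\<^sub>R k) + scA \<i> (Re a *\<^sub>R k + Im a *\<^sub>R h)"
    by (simp add: A.sc_complex[of a] x A.sc_add A.sc_scaleR A.sc_i_i algebra_simps)
  have "J (scA a x) = L (Re a *\<^sub>R h - Im a *\<^sub>R k) + scB \<i> (L (Re a *\<^sub>R k + Im a *\<^sub>R h))"
    unfolding ax by (rule J_decomp) (use x in \<open>simp_all add: A.sa_intros\<close>)
  also have "\<dots> = (Re a *\<^sub>R L h - Im a *\<^sub>R L k) + scB \<i> (Re a *\<^sub>R L k + Im a *\<^sub>R L h)"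
    using x by (simp add: L_diff L_add L_scaleR A.sa_intros)
  also have "\<dots> = scB a (J x)"
    using x by (simp add: B.sc_complex[of a] J_decomp B.sc_add B.sc_scaleR B.sc_i_i algebra_simps)
  finally show ?thesis .
qed

lemma J_jordan: "J (x * y + y * x) = J x * J y + J y * J x"
proof -
  obtain h k where x: "A.sa h" "A.sa k" "x = h + scA \<i> k" by (rule A.sa_decomp)
  obtain h' k' where y: "A.sa h'" "A.sa k'" "y = h' + scA \<i> k'" by (rule A.sa_decomp)
  define p where "p = (h * h' + h' * h) - (k * k' + k' * k)"
  define q where "q = (h * k' + k' * h) + (k * h' + h' * k)"
  have jsa: "A.sa (u * v + v * u)" if "A.sa u" "A.sa v" for u v
    using that by (simp add: A.st_add A.st_mult add.commute)
  have pq: "A.sa p" "A.sa q" unfolding p_def q_def by (intro A.sa_intros jsa x y)+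
  have "x * y + y * x = p + scA \<i> q"
    by (simp add: x y p_def q_def distrib_left distrib_right A.sc_mult_left A.sc_mult_right A.sc_add A.sc_i_i)
  then have "J (x * y + y * x) = L p + scB \<i> (L q)" using J_decomp[OF pq] by simp
  also have "L p = (L h * L h' + L h' * L h) - (L k * L k' + L k' * L k)"
    unfolding p_def using x y by (simp add: L_diff L_jordan jsa)
  also have "L q = (L h * L k' + L k' * L h) + (L k * L h' + L h' * L k)"
    unfolding q_def using x y by (simp add: L_add L_jordan jsa)
  finally show ?thesis
    by (simp add: x y J_decomp distrib_left distrib_right B.sc_mult_left B.sc_mult_right B.sc_add B.sc_i_i)
qed

lemma J_st: "J (stA x) = stB (J x)"
proof -
  obtain h k where x: "A.sa h" "A.sa k" "x = h + scA \<i> k" by (rule A.sa_decomp)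
  have "stA x = h + scA \<i> (- k)" using x by (simp add: A.st_add A.st_sc A.sc_uminus A.sc_minus)
  then have "J (stA x) = L h + scB \<i> (L (- k))" using J_decomp[of h "- k"] x by (simp add: A.sa_intros)
  also have "L (- k) = - L k" using L_scaleR[of k "-1"] x by simp
  also have "L h + scB \<i> (- L k) = stB (J x)"
    using x L_sa by (simp add: J_decomp B.st_add B.st_sc B.sc_uminus B.sc_minus)
  finally show ?thesis .
qed

lemma J_bij: "bij J"
proof (rule bijI)
  show "inj J"
  proof (rule injI)
    fix x y assume eq: "J x = J y"
    obtain h k where x: "A.sa h" "A.sa k" "x = h + scA \<i> k" by (rule A.sa_decomp)
    obtain h' k' where y: "A.sa h'" "A.sa k'" "y = h' + scA \<i> k'" by (rule A.sa_decomp)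
    have "L h = L h' \<and> L k = L k'"
      by (rule B.sa_decomp_unique) (use eq x y in \<open>simp_all add: L_sa J_decomp\<close>)
    then have "h = h'" "k = k'" using KL x y by metis+
    then show "x = y" by (simp add: x y)
  qed
  show "surj J"
  proof (rule surjI)
    fix y
    obtain h k where y: "B.sa h" "B.sa k" "y = h + scB \<i> k" by (rule B.sa_decomp)
    then show "J ((\<lambda>y. SOME x. J x = y) y) = y"
      using J_decomp[of "K h" "K k"] by (auto simp: K_sa LK intro: someI)
  qed
qed

lemma jordan_star_iso_J: "jordan_star_iso scA stA scB stB J"
  unfolding jordan_star_iso_def using J_add J_scA J_bij J_jordan J_st by blast

text \<open>The identities so far concern real parts of traces. As \<open>c\<close> is central,
  \<open>exp c * L h\<close> is self-adjoint, so its trace is real and nothing is lost.\<close>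

lemma omega_exp_c_J: "\<omega> (exp c * J x) = complex_of_real k * \<tau> x"
proof -
  obtain h g where x: "A.sa h" "A.sa g" "x = h + scA \<i> g" by (rule A.sa_decomp)
  have *: "\<omega> (exp c * L h) = complex_of_real k * \<tau> h" if h: "A.sa h" for h
  proof -
    have "B.sa (exp c * L h)" 
      using exp_commute[of c "L h"] c_commutes h by (simp add: B.st_mult B.sa_intros c_sa L_sa)
    moreover have "B.t (exp c * L h) = k * A.t h"
      using trace_weighted[OF A.sa_intros(2) h] by (simp add: L_one)
    ultimately show ?thesis using h by (simp add: A.tau_sa B.tau_sa)
  qed
  show ?thesis using *[OF x(1)] *[OF x(2)]
    by (simp add: x J_decomp distrib_left B.sc_mult_right B.tau_add B.tau_sc A.tau_add A.tau_sc algebra_simps)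
qed

end

section \<open>Surjections preserving the normalized quantity\<close>

context tracial
begin

text \<open>As \<alpha> is nonzero, \<open>\<alpha> x + \<beta> b'\<close> runs through all
  self-adjoint elements along with \<open>x\<close>.\<close>

lemma shifted_ratio_le_iff:
  assumes "sa b" "sa b'" "\<alpha> \<noteq> 0"
  shows "(\<forall>x. sa x \<longrightarrow> t (exp (\<alpha> *\<^sub>R x + \<beta> *\<^sub>R b)) \<le> exp r * t (exp (\<alpha> *\<^sub>R x + \<beta> *\<^sub>R b'))) \<longleftrightarrow>
         (\<forall>u. sa u \<longrightarrow> t (exp u * (\<beta> *\<^sub>R (b - b'))) \<le> r * t (exp u))"
proof -
  have "(\<forall>x. sa x \<longrightarrow> t (exp (\<alpha> *\<^sub>R x + \<beta> *\<^sub>R b)) \<le> exp r * t (exp (\<alpha> *\<^sub>R x + \<beta> *\<^sub>R b'))) \<longleftrightarrow>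
        (\<forall>x. sa x \<longrightarrow> t (exp (x + \<beta> *\<^sub>R (b - b'))) \<le> exp r * t (exp x))"
  proof (intro iffI allI impI)
    fix x assume *: "\<forall>x. sa x \<longrightarrow> t (exp (\<alpha> *\<^sub>R x + \<beta> *\<^sub>R b)) \<le> exp r * t (exp (\<alpha> *\<^sub>R x + \<beta> *\<^sub>R b'))" "sa x"
    have "sa ((1 / \<alpha>) *\<^sub>R (x - \<beta> *\<^sub>R b'))" using *(2) assms(2) by (intro sa_intros)
    from *(1)[rule_format, OF this] show "t (exp (x + \<beta> *\<^sub>R (b - b'))) \<le> exp r * t (exp x)"
      using assms(3) by (simp add: algebra_simps)
  next
    fix x assume *: "\<forall>x. sa x \<longrightarrow> t (exp (x + \<beta> *\<^sub>R (b - b'))) \<le> exp r * t (exp x)" "sa x"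
    have "sa (\<alpha> *\<^sub>R x + \<beta> *\<^sub>R b')" using *(2) assms(2) by (intro sa_intros)
    from *(1)[rule_format, OF this]
    show "t (exp (\<alpha> *\<^sub>R x + \<beta> *\<^sub>R b)) \<le> exp r * t (exp (\<alpha> *\<^sub>R x + \<beta> *\<^sub>R b'))"
      by (simp add: algebra_simps)
  qed
  also have "\<dots> \<longleftrightarrow> (\<forall>u. sa u \<longrightarrow> t (exp u * (\<beta> *\<^sub>R (b - b'))) \<le> r * t (exp u))"
    by (rule ratio_le_iff) (use assms in \<open>simp add: sa_intros\<close>)
  finally show ?thesis .
qed

lemma N_scaled_diff_le_iff:
  assumes "sa b" "sa b'" "\<alpha> \<noteq> 0"
  shows "\<bar>\<beta>\<bar> * N (b - b') \<le> r \<longleftrightarrow>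
    (\<forall>x. sa x \<longrightarrow> t (exp (\<alpha> *\<^sub>R x + \<beta> *\<^sub>R b)) \<le> exp r * t (exp (\<alpha> *\<^sub>R x + \<beta> *\<^sub>R b')) \<and>
       t (exp (\<alpha> *\<^sub>R x + \<beta> *\<^sub>R b')) \<le> exp r * t (exp (\<alpha> *\<^sub>R x + \<beta> *\<^sub>R b)))"
proof -
  interpret normed_subspace "{h. sa h}" N by (rule normed_subspace_sa)
  have h: "sa (b - b')" "sa (\<beta> *\<^sub>R (b - b'))" using assms by (simp_all add: sa_intros)
  have m: "t (exp u * (\<beta> *\<^sub>R (b' - b))) = - t (exp u * (\<beta> *\<^sub>R (b - b')))" for u
    by (simp add: t_scaleR right_diff_distrib t_diff algebra_simps)
  have "\<bar>\<beta>\<bar> * N (b - b') \<le> r \<longleftrightarrow> N (\<beta> *\<^sub>R (b - b')) \<le> r" using N_scaleR[of "b - b'" \<beta>] h by simp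
  also have "\<dots> \<longleftrightarrow> (\<forall>u. sa u \<longrightarrow> t (exp u * (\<beta> *\<^sub>R (b - b'))) \<le> r * t (exp u)) \<and>
      (\<forall>u. sa u \<longrightarrow> t (exp u * (\<beta> *\<^sub>R (b' - b))) \<le> r * t (exp u))"
    unfolding N_le_iff[OF h(2)] m by (auto simp: abs_le_iff)
  finally show ?thesis
    using shifted_ratio_le_iff[OF assms(1,2,3), of \<beta> r] shifted_ratio_le_iff[OF assms(2,1,3), of \<beta> r]
    by blast
qed

end

section \<open>The preserving surjection in logarithmic coordinates\<close>

locale entropy_preserver = A: tracial scA stA \<tau> + B: tracial scB stB \<omega>
  for scA :: "complex \<Rightarrow> 'a::{real_normed_algebra_1,banach} \<Rightarrow> 'a" and stA :: "'a \<Rightarrow> 'a" and \<tau> :: "'a \<Rightarrow> complex"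
    and scB :: "complex \<Rightarrow> 'b::{real_normed_algebra_1,banach} \<Rightarrow> 'b" and stB :: "'b \<Rightarrow> 'b" and \<omega> :: "'b \<Rightarrow> complex" +
  fixes \<alpha> :: real and \<phi> :: "'a \<Rightarrow> 'b"
  assumes alpha: "\<alpha> \<noteq> 0" "\<alpha> \<noteq> 1"
    and phi_surj: "\<phi> ` pos_inv stA = pos_inv stB"
    and preserves: "X \<in> pos_inv stA \<Longrightarrow> Y \<in> pos_inv stA \<Longrightarrow>
      Qmo \<omega> stB \<alpha> (\<phi> X) (\<phi> Y) / \<omega> (\<phi> X) = Qmo \<tau> stA \<alpha> X Y / \<tau> X"
begin

definition f :: "'a \<Rightarrow> 'b" where "f x = clog stB (\<phi> (exp x))"

lemma phi_exp:
  assumes "A.sa x"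
  shows "B.sa (f x)" "\<phi> (exp x) = exp (f x)"
proof -
  have "\<phi> (exp x) \<in> exp ` {y. B.sa y}"
    using phi_surj assms unfolding A.pos_inv_eq B.pos_inv_eq by blast
  then obtain y where y: "B.sa y" "\<phi> (exp x) = exp y" by auto
  then have "f x = y" by (simp add: f_def B.clog_exp)
  then show "B.sa (f x)" "\<phi> (exp x) = exp (f x)" using y by simp_all
qed

lemma f_surj: "f ` {x. A.sa x} = {y. B.sa y}"
proof (intro equalityI subsetI)
  fix y assume "y \<in> {y. B.sa y}"
  then have y: "B.sa y" by simp
  then have "exp y \<in> \<phi> ` exp ` {x. A.sa x}"
    using phi_surj unfolding A.pos_inv_eq B.pos_inv_eq by blast
  then obtain x where x: "A.sa x" "\<phi> (exp x) = exp y" by auto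
  then have "f x = y" using y by (simp add: f_def B.clog_exp)
  then show "y \<in> f ` {x. A.sa x}" using x by blast
qed (auto simp: phi_exp)

lemma trace_ratio:
  assumes "A.sa a" "A.sa b"
  shows "B.t (exp (\<alpha> *\<^sub>R f a + (1 - \<alpha>) *\<^sub>R f b)) / B.t (exp (f a)) =
    A.t (exp (\<alpha> *\<^sub>R a + (1 - \<alpha>) *\<^sub>R b)) / A.t (exp a)"
proof -
  have "exp a \<in> pos_inv stA" "exp b \<in> pos_inv stA" using assms by (auto simp: A.pos_inv_eq)
  from preserves[OF this]
  have "complex_of_real (B.t (exp (\<alpha> *\<^sub>R f a + (1 - \<alpha>) *\<^sub>R f b)) / B.t (exp (f a))) =
    complex_of_real (A.t (exp (\<alpha> *\<^sub>R a + (1 - \<alpha>) *\<^sub>R b)) / A.t (exp a))"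
    using assms by (simp add: Qmo_def phi_exp A.clog_exp B.clog_exp A.tau_sa B.tau_sa A.sa_intros B.sa_intros)
  then show ?thesis by (simp only: of_real_eq_iff)
qed

text \<open>The denominators in \<open>trace_ratio\<close> depend on the first argument only, so
  inequalities between two second arguments carry over. By surjectivity these cover all test
  elements, and they determine the upper bounds of the norm.\<close>

lemma f_isometry:
  assumes "A.sa b" "A.sa b'"
  shows "B.N (f b - f b') = A.N (b - b')"
proof -
  let ?\<beta> = "1 - \<alpha>"
  have le: "B.t (exp (\<alpha> *\<^sub>R f x + ?\<beta> *\<^sub>R f p)) \<le> exp r * B.t (exp (\<alpha> *\<^sub>R f x + ?\<beta> *\<^sub>R f q)) \<longleftrightarrow>
      A.t (exp (\<alpha> *\<^sub>R x + ?\<beta> *\<^sub>R p)) \<le> exp r * A.t (exp (\<alpha> *\<^sub>R x + ?\<beta> *\<^sub>R q))"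
    if "A.sa x" "A.sa p" "A.sa q" for x p q r
  proof -
    define m where "m = B.t (exp (f x)) / A.t (exp x)"
    have pos: "0 < B.t (exp (f x))" "0 < A.t (exp x)"
      using that by (simp_all add: A.t_exp_pos B.t_exp_pos phi_exp)
    then have m: "0 < m" by (simp add: m_def)
    have e: "B.t (exp (\<alpha> *\<^sub>R f x + ?\<beta> *\<^sub>R f p)) = m * A.t (exp (\<alpha> *\<^sub>R x + ?\<beta> *\<^sub>R p))" if "A.sa p" for p
      using trace_ratio[OF \<open>A.sa x\<close> that] pos by (simp add: m_def field_simps)
    have "exp r * (m * v) = m * (exp r * v)" for v by simp
    then show ?thesis using m by (simp only: e that mult_le_cancel_left_pos)
  qed
  have iff: "\<bar>?\<beta>\<bar> * B.N (f b - f b') \<le> r \<longleftrightarrow> \<bar>?\<beta>\<bar> * A.N (b - b') \<le> r" for r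
  proof -
    have all: "(\<forall>y. B.sa y \<longrightarrow> P y) \<longleftrightarrow> (\<forall>x. A.sa x \<longrightarrow> P (f x))" for P
    proof (intro iffI allI impI)
      fix y assume *: "\<forall>x. A.sa x \<longrightarrow> P (f x)" "B.sa y"
      then have "y \<in> f ` {x. A.sa x}" using f_surj by simp
      then show "P y" using *(1) by blast
    qed (use phi_exp(1) in blast)
    show ?thesis
      unfolding B.N_scaled_diff_le_iff[OF phi_exp(1)[OF assms(1)] phi_exp(1)[OF assms(2)] alpha(1)]
        A.N_scaled_diff_le_iff[OF assms alpha(1)] all
      using le[OF _ assms] le[OF _ assms(2,1)] by blast
  qed
  have "\<bar>?\<beta>\<bar> * B.N (f b - f b') = \<bar>?\<beta>\<bar> * A.N (b - b')"
    using iff[of "\<bar>?\<beta>\<bar> * B.N (f b - f b')"] iff[of "\<bar>?\<beta>\<bar> * A.N (b - b')"] by simp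
  then show ?thesis using alpha(2) by simp
qed

lemma surjective_isometry_f: "surjective_isometry {x. A.sa x} A.N {y. B.sa y} B.N f"
  by (intro surjective_isometry.intro surjective_isometry_axioms.intro A.normed_subspace_sa
      B.normed_subspace_sa f_surj) (simp add: f_isometry)

lemma representation:
  obtains C J where "C \<in> pos_inv stB" "central C" "jordan_star_iso scA stA scB stB J"
    "\<And>X. X \<in> pos_inv stA \<Longrightarrow> \<phi> X = C * J X"
    "\<And>X. \<omega> (C * J X) = \<omega> C / \<tau> 1 * \<tau> X"
proof -
  interpret I: surjective_isometry "{x. A.sa x}" A.N "{y. B.sa y}" B.N f
    by (rule surjective_isometry_f)
  define c where "c = f 0"
  define k where "k = B.t (exp c) / A.t 1"
  define K where "K = inv_into {x. A.sa x} I.L"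
  have c: "B.sa c" by (simp add: c_def phi_exp)
  have k: "0 < k" using B.t_exp_pos[OF c] A.t_one_pos by (simp add: k_def)
  have trace: "B.t (exp (c + I.L x)) = k * A.t (exp x)" if x: "A.sa x" for x
  proof -
    \<comment> \<open>With first argument \<open>0\<close> and this second argument, the mixture
      becomes \<open>x\<close> on one side and \<open>c + L x\<close> on the other.\<close>
    let ?b = "(1 / (1 - \<alpha>)) *\<^sub>R x"
    have b: "A.sa ?b" using x by (simp add: A.sa_intros)
    have "I.L x = (1 - \<alpha>) *\<^sub>R I.L ?b" using I.L_scaleR[of ?b "1 - \<alpha>"] alpha b by simp
    then have 1: "\<alpha> *\<^sub>R f 0 + (1 - \<alpha>) *\<^sub>R f ?b = c + I.L x"
      by (simp add: I.L_def c_def algebra_simps)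
    have 2: "\<alpha> *\<^sub>R 0 + (1 - \<alpha>) *\<^sub>R ?b = x" using alpha by simp
    have "B.t (exp (c + I.L x)) / B.t (exp c) = A.t (exp x) / A.t 1"
      using trace_ratio[OF A.sa_intros(1) b] unfolding 1 2 by (simp add: c_def)
    then show ?thesis using B.t_exp_pos[OF c] A.t_one_pos by (simp add: k_def field_simps)
  qed
  interpret P: trace_pair scA stA \<tau> scB stB \<omega> I.L K c k
  proof unfold_locales
    show "A.sa (K y)" if "B.sa y" for y
      using bij_betwE[OF bij_betw_inv_into[OF I.L_bij]] that by (auto simp: K_def)
    show "K (I.L x) = x" if "A.sa x" for x
      using bij_betw_inv_into_left[OF I.L_bij] that by (simp add: K_def)
    show "I.L (K y) = y" if "B.sa y" for y
      using bij_betw_inv_into_right[OF I.L_bij] that by (simp add: K_def)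
    show "B.sa (I.L x)" if "A.sa x" for x using I.L_in[of x] that by simp
  qed (simp_all add: I.L_add I.L_scaleR c k trace)
  show thesis
  proof (rule that[of "exp c" P.J])
    show "exp c \<in> pos_inv stB" using c by (auto simp: B.pos_inv_eq)
    show "central (exp c)" unfolding central_def using exp_commute[OF P.c_commutes] by blast
    show "jordan_star_iso scA stA scB stB P.J" by (rule P.jordan_star_iso_J)
    show "\<phi> X = exp c * P.J X" if X: "X \<in> pos_inv stA" for X
    proof -
      obtain x where x: "A.sa x" "X = exp x" using X by (auto simp: A.pos_inv_eq)
      have "f x = c + I.L x" by (simp add: I.L_def c_def)
      then show ?thesis
        using x by (simp add: phi_exp P.J_sa A.sa_intros P.L_exp exp_add_commuting P.c_commutes)
    qed
    show "\<omega> (exp c * P.J X) = \<omega> (exp c) / \<tau> 1 * \<tau> X" for X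
      unfolding P.omega_exp_c_J by (simp add: k_def A.tau_sa B.tau_sa B.sa_intros c)
  qed
qed

end

section \<open>The converse\<close>

locale jordan_representation = A: tracial scA stA \<tau> + B: tracial scB stB \<omega>
  for scA :: "complex \<Rightarrow> 'a::{real_normed_algebra_1,banach} \<Rightarrow> 'a" and stA :: "'a \<Rightarrow> 'a" and \<tau> :: "'a \<Rightarrow> complex"
    and scB :: "complex \<Rightarrow> 'b::{real_normed_algebra_1,banach} \<Rightarrow> 'b" and stB :: "'b \<Rightarrow> 'b" and \<omega> :: "'b \<Rightarrow> complex" +
  fixes C :: 'b and J :: "'a \<Rightarrow> 'b" and \<phi> :: "'a \<Rightarrow> 'b"
  assumes C: "C \<in> pos_inv stB" "central C"
    and jordan: "jordan_star_iso scA stA scB stB J"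
    and phi: "X \<in> pos_inv stA \<Longrightarrow> \<phi> X = C * J X"
    and omega_CJ: "\<omega> (C * J X) = \<omega> C / \<tau> 1 * \<tau> X"
begin

definition k :: real where "k = B.t C / A.t 1"

definition c :: 'b where "c = clog stB C"

lemma exp_c: "B.sa c" "exp c = C"
  using C(1) B.clog_exp unfolding B.pos_inv_eq c_def by auto

lemma c_commutes: "c * y = y * c"
proof (rule B.commute_of_sa)
  fix g
  show "c * g = g * c"
    by (rule B.exp_intertwine) (use C(2) in \<open>simp_all add: exp_c central_def\<close>)
qed

lemma k_pos: "0 < k"
  using B.t_exp_pos[OF exp_c(1)] A.t_one_pos by (simp add: k_def exp_c)

lemma omega_eq: "\<omega> (C * J X) = complex_of_real k * \<tau> X"
  using omega_CJ[of X] B.tau_sa[of C] A.tau_sa[of 1] B.sa_intros(7)[OF exp_c(1)]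
  by (simp add: k_def exp_c)

lemma t_CJ: "B.t (C * J X) = k * A.t X"
  by (simp add: B.t_def A.t_def omega_eq)

lemma J_add: "J (x + y) = J x + J y"
  and J_sc: "J (scA a x) = scB a (J x)"
  and J_mult: "J (x * y + y * x) = J x * J y + J y * J x"
  and J_st: "J (stA x) = stB (J x)"
  and J_bij: "bij J"
  using jordan unfolding jordan_star_iso_def
  by - (elim conjE, ((erule allE)+)?, assumption)+

lemma J_scaleR: "J (r *\<^sub>R x) = r *\<^sub>R J x"
  using J_sc[of "complex_of_real r" x] by (simp add: A.sc_of_real B.sc_of_real)

lemma J_sa: "A.sa x \<Longrightarrow> B.sa (J x)"
  using J_st[of x] by simp

text \<open>The Jordan identity is applied to \<open>1\<close> and a preimage of
  \<open>1\<close>.\<close>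

lemma J_one: "J 1 = 1"
proof -
  obtain x where x: "J x = 1" using J_bij by (metis bij_pointE)
  have "2 *\<^sub>R J x = 2 *\<^sub>R J 1" using J_mult[of x 1] by (simp add: x scaleR_2 J_add)
  then show ?thesis using x by simp
qed

lemma J_power: "J (x ^ n) = J x ^ n"
proof (induction n)
  case (Suc n)
  have "2 *\<^sub>R J (x ^ Suc n) = J (x * x ^ n + x ^ n * x)"
    by (simp add: power_commutes J_add scaleR_2)
  also have "\<dots> = 2 *\<^sub>R J x ^ Suc n" unfolding J_mult Suc by (simp add: power_commutes scaleR_2)
  finally show ?case by simp
qed (simp add: J_one)

text \<open>\<open>J\<close> respects symmetrized products, and a trace with central weight does not
  distinguish a product from its symmetrization.\<close>

lemma t_CJJ: "B.t (C * J x * J y) = k * A.t (x * y)"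
proof -
  have "B.t (C * J y * J x) = B.t (C * J x * J y)"
    using B.t_commute[of "C * J y" "J x"] C(2) by (simp add: central_def mult.assoc)
  moreover have "B.t (C * J (x * y + y * x)) = 2 * (k * A.t (x * y))"
    unfolding t_CJ using A.t_commute[of x y] by (simp add: A.t_add)
  ultimately show ?thesis unfolding J_mult by (simp add: distrib_left B.t_add mult.assoc)
qed

text \<open>Continuity of \<open>J\<close> is not assumed, so the exponential series is compared term by term under
  the trace.\<close>

lemma J_exp:
  assumes a: "A.sa a"
  shows "J (exp a) = exp (J a)"
proof -
  have eq: "B.t (C * J (exp a) * J y) = B.t (C * exp (J a) * J y)" for y
  proof -
    interpret F: bounded_linear "\<lambda>x. k * A.t (x * y)"
      using bounded_linear_compose[OF bounded_linear_mult_right[of k] bounded_linear_compose[OF A.bounded_linear_t bounded_linear_mult_left[of y]]] .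
    interpret G: bounded_linear "\<lambda>x. B.t (C * x * J y)"
      using bounded_linear_compose[OF B.bounded_linear_t bounded_linear_compose[OF bounded_linear_mult_left[of "J y"] bounded_linear_mult_right[of C]]] .
    have "B.t (C * J (exp a) * J y) = k * A.t (exp a * y)" by (rule t_CJJ)
    also have "\<dots> = (\<Sum>n. k * A.t ((a ^ n /\<^sub>R fact n) * y))"
      unfolding exp_def by (rule F.suminf[OF summable_exp_generic])
    also have "\<dots> = (\<Sum>n. B.t (C * (J a ^ n /\<^sub>R fact n) * J y))"
      by (rule suminf_cong) (simp only: t_CJJ[symmetric] J_scaleR J_power)
    also have "\<dots> = B.t (C * exp (J a) * J y)"
      unfolding exp_def by (rule G.suminf[OF summable_exp_generic, symmetric])
    finally show ?thesis .
  qed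
  define z where "z = J (exp a) - exp (J a)"
  have z: "B.sa z" by (simp add: z_def B.sa_intros J_sa A.sa_intros a)
  obtain y where y: "J y = z" using J_bij by (metis bij_pointE)
  have "B.t (exp c * z * exp 0 * stB z) = 0"
    using eq[of y] z unfolding y by (simp add: exp_c z_def left_diff_distrib right_diff_distrib B.t_diff)
  then have "z = 0" using B.t_exp_conj_nonneg(2)[OF exp_c(1) B.sa_intros(1)] by blast
  then show ?thesis by (simp add: z_def)
qed

lemma phi_exp:
  assumes "A.sa a"
  shows "\<phi> (exp a) = exp (c + J a)"
proof -
  have "\<phi> (exp a) = C * J (exp a)" by (rule phi) (use assms in \<open>auto simp: A.pos_inv_eq\<close>)
  then show ?thesis using assms by (simp add: J_exp exp_add_commuting c_commutes exp_c)
qed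

lemma preserves:
  assumes "X \<in> pos_inv stA" "Y \<in> pos_inv stA"
  shows "Qmo \<omega> stB \<alpha> (\<phi> X) (\<phi> Y) / \<omega> (\<phi> X) = Qmo \<tau> stA \<alpha> X Y / \<tau> X"
proof -
  obtain a b where a: "A.sa a" "X = exp a" and b: "A.sa b" "Y = exp b"
    using assms by (auto simp: A.pos_inv_eq)
  define w where "w = \<alpha> *\<^sub>R a + (1 - \<alpha>) *\<^sub>R b"
  have w: "A.sa w" by (simp add: w_def a b A.sa_intros)
  have om: "\<omega> (\<phi> (exp x)) = complex_of_real k * \<tau> (exp x)" if "A.sa x" for x
    using omega_eq[of "exp x"] phi[of "exp x"] that by (auto simp: A.pos_inv_eq)
  \<comment> \<open>The weights sum to \<open>1\<close>, so \<open>c\<close> survives exactly once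
    and the mixture is the logarithm of \<open>\<phi> (exp w)\<close>.\<close>
  have "\<alpha> *\<^sub>R (c + J a) + (1 - \<alpha>) *\<^sub>R (c + J b) = c + J w"
    unfolding w_def J_add J_scaleR by (simp add: algebra_simps)
  then have "Qmo \<omega> stB \<alpha> (\<phi> X) (\<phi> Y) = \<omega> (\<phi> (exp w))"
    using a b w by (simp add: Qmo_def phi_exp B.clog_exp B.sa_intros exp_c(1) J_sa)
  moreover have "Qmo \<tau> stA \<alpha> X Y = \<tau> (exp w)"
    using a b by (simp add: Qmo_def A.clog_exp w_def)
  ultimately show ?thesis using k_pos om[OF w] om[OF a(1)] by (simp add: a(2))
qed

lemma scaled_pos_inv:
  assumes "0 < r" "Y \<in> pos_inv stB"
  shows "r *\<^sub>R Y \<in> pos_inv stB"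
proof -
  obtain y where "B.sa y" "Y = exp y" using assms(2) by (auto simp: B.pos_inv_eq)
  then show ?thesis using assms(1) exp_add_scaleR_one[of y "ln r"]
    unfolding B.pos_inv_eq by (intro image_eqI[of _ _ "y + ln r *\<^sub>R 1"]) (simp_all add: B.sa_intros)
qed

text \<open>The constant \<open>k\<close> is the factor by which \<open>X \<mapsto> C * J X\<close>
  scales the trace, so \<open>C / k\<close> is the required central element.\<close>

lemma standard_form_scaled:
  assumes "\<phi> ` pos_inv stA = pos_inv stB"
  shows "standard_form scA stA \<tau> scB stB \<omega> (\<lambda>X. (1/k) *\<^sub>R \<phi> X)"
  unfolding standard_form_def
proof (intro conjI exI[of _ "(1/k) *\<^sub>R C"] exI[of _ J] ballI allI)
  show "(\<lambda>X. (1/k) *\<^sub>R \<phi> X) ` pos_inv stA \<subseteq> pos_inv stB"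
    using assms scaled_pos_inv[of "1/k"] k_pos by auto
  show "(1/k) *\<^sub>R C \<in> pos_inv stB" using scaled_pos_inv[of "1/k"] k_pos C by simp
  show "central ((1/k) *\<^sub>R C)" using C by (simp add: central_def)
  show "jordan_star_iso scA stA scB stB J" by (rule jordan)
  show "(1/k) *\<^sub>R \<phi> X = (1/k) *\<^sub>R C * J X" if "X \<in> pos_inv stA" for X using phi[OF that] by simp
  show "\<omega> ((1/k) *\<^sub>R C * J X) = \<tau> X" for X
    using k_pos B.tau_scaleR[of "1/k" "C * J X"] by (simp add: omega_eq)
qed

end

section \<open>Equivalence of preservation and representation, with the standard form\<close>

theorem theorem22:
  fixes scA :: "complex \<Rightarrow> 'a::{real_normed_algebra_1,banach} \<Rightarrow> 'a" and stA :: "'a \<Rightarrow> 'a"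
    and scB :: "complex \<Rightarrow> 'b::{real_normed_algebra_1,banach} \<Rightarrow> 'b" and stB :: "'b \<Rightarrow> 'b"
    and \<tau> :: "'a \<Rightarrow> complex" and \<omega> :: "'b \<Rightarrow> complex"
    and \<alpha> :: real and \<phi> :: "'a \<Rightarrow> 'b"
  assumes "unital_cstar_algebra scA stA" and "unital_cstar_algebra scB stB"
    and "faithful_trace scA stA \<tau>" and "faithful_trace scB stB \<omega>"
    and "\<alpha> > 0" and "\<alpha> \<noteq> 1"
    and "\<phi> ` pos_inv stA = pos_inv stB"
  shows "((\<forall>A \<in> pos_inv stA. \<forall>B \<in> pos_inv stA.
            Qmo \<omega> stB \<alpha> (\<phi> A) (\<phi> B) / \<omega> (\<phi> A) = Qmo \<tau> stA \<alpha> A B / \<tau> A)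
          \<longleftrightarrow>
          (\<exists>C J. C \<in> pos_inv stB \<and> central C \<and> jordan_star_iso scA stA scB stB J \<and>
             (\<forall>A \<in> pos_inv stA. \<phi> A = C * J A) \<and>
             (\<forall>X. \<omega> (C * J X) = \<omega> C / \<tau> 1 * \<tau> X)))
       \<and> ((\<forall>A \<in> pos_inv stA. \<forall>B \<in> pos_inv stA.
            Qmo \<omega> stB \<alpha> (\<phi> A) (\<phi> B) / \<omega> (\<phi> A) = Qmo \<tau> stA \<alpha> A B / \<tau> A)
          \<longrightarrow> (\<exists>(c::real) \<psi>. c > 0 \<and> standard_form scA stA \<tau> scB stB \<omega> \<psi> \<and>
                  (\<forall>A \<in> pos_inv stA. \<phi> A = c *\<^sub>R \<psi> A)))"
    (is "(?preserves \<longleftrightarrow> ?representation) \<and> (?preserves \<longrightarrow> ?standard)")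
proof -
  interpret A: tracial scA stA \<tau> by unfold_locales (fact assms)+
  interpret B: tracial scB stB \<omega> by unfold_locales (fact assms)+
  have 1: ?representation if ?preserves
  proof -
    interpret entropy_preserver scA stA \<tau> scB stB \<omega> \<alpha> \<phi>
      by unfold_locales (use assms that in auto)
    show ?thesis by (rule representation) blast
  qed
  \<comment> \<open>The standard form is read off from the representation, so the second conjunct is
    reached through the first.\<close>
  have 2: "?preserves \<and> ?standard" if ?representation
  proof -
    from that obtain C J where CJ: "C \<in> pos_inv stB" "central C" "jordan_star_iso scA stA scB stB J"
      "\<forall>A \<in> pos_inv stA. \<phi> A = C * J A" "\<forall>X. \<omega> (C * J X) = \<omega> C / \<tau> 1 * \<tau> X"
      by blast
    interpret jordan_representation scA stA \<tau> scB stB \<omega> C J \<phi>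
      by unfold_locales (use CJ in auto)
    have ?standard
      using k_pos standard_form_scaled[OF assms(7)]
      by (intro exI[of _ k] exI[of _ "\<lambda>X. (1/k) *\<^sub>R \<phi> X"]) simp
    then show ?thesis using preserves by blast
  qed
  show ?thesis using 1 2 by blast
qed

end
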